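(* Let $\mathcal{V}$ be the category of JB*-triples, and let $\mathcal{C}$ be the category of Tits–Kantor–Koecher Lie algebras of JB*-triples. Define $F:\mathcal{V}\to\mathcal{C}$ on objects by $FV:=\mathfrak{L}(V)$ and on morphisms $\varphi:V\to W$ by $F\varphi:FV\to FW$, $$F\varphi(x,h,y):=(\varphi(x),\ \varphi\circ h\circ\varphi^{-1},\ \varphi(y)),\qquad (x,h,y)\in FV.$$ Then $F:\mathcal{V}\to\mathcal{C}$ is an equivalence of categories.
   Context: A Hermitian Jordan triple $V$ is a complex vector space with a triple product $\{\cdot,\cdot,\cdot\}:V^3\to V$, symmetric and linear in the outer variables, conjugate linear in the middle variable, satisfying $\{a,b,\{x,y,z\}\}=\{\{a,b,x\},y,z\}-\{x,\{b,a,y\},z\}+\{x,y,\{a,b,z\}\}$. The box operator $a\,\square\, b:V\to V$ is $a\,\square\, b(x)=\{a,b,x\}$. A JB*-triple is a Hermitian Jordan triple that is a complex Banach space with continuous triple product such that, for all $a$, $a\,\square\, a$ is a Hermitian operator with non-negative spectrum and $\|a\,\square\, a\|=\|a\|^2$. A triple isomorphism is a linear bijection preserving the triple product. TKK Lie algebra of $V$: $\mathfrak{L}(V)=V\oplus V_0\oplus\overline{V}$, where $V_0$ is the linear span of the box operators on $V$ and $\overline{V}$ is the conjugate of $V$ (the same set and addition, with scalar multiplication $\lambda\cdot x=\overline{\lambda}x$). The Lie product is $$[(x,h,y),(u,k,v)]=(h(u)-k(x),\,[h,k]+x\,\square\, v-u\,\square\, y,\,k^\natural(y)-h^\natural(v)),$$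 where $h^\natural=\sum_j b_j\,\square\, a_j$ for $h=\sum_j a_j\,\square\, b_j\in V_0$. The involution is $\theta(x,h,y)=(y,-h^\natural,x)$. The grading is $\mathfrak{L}(V)_{-1}=V$, $\mathfrak{L}(V)_0=V_0$, $\mathfrak{L}(V)_1=\overline{V}$. $\mathcal{V}$: objects are JB*-triples, morphisms are triple isomorphisms. $\mathcal{C}$: objects are the TKK Lie algebras associated with JB*-triples via the Tits–Kantor–Koecher construction, which assigns to each JB*-triple $V$ the 3-graded Lie algebra $\mathfrak{L}(V)=V\oplus V_0\oplus\overline{V}$ with Lie product $[(x,h,y),(u,k,v)]=(h(u)-k(x),\,[h,k]+x\,\square\, v-u\,\square\, y,\,k^\natural(y)-h^\natural(v))$ and involution $\theta(x,h,y)=(y,-h^\natural,x)$; morphisms are the graded isomorphisms commuting with involutions, i.e. linear bijections $T$ preserving the Lie product, mapping the degree $j$ component into the degree $j$ component for $j=-1,0,1$, and satisfying $T\theta=\theta'T$ for the respective involutions $\theta,\theta'$. *)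

theory Defs
  imports "HOL-Analysis.Analysis" "HOL-Algebra.Module"
begin

section \<open>Categories and equivalences\<close>

text \<open>Morphisms are typed by their domain and codomain: the hom sets need not be disjoint, and
  every operation on morphisms takes the objects involved as arguments.
  \<open>Comp C X Y Z g f\<close> is the composite of \<open>f : X \<rightarrow> Y\<close> and \<open>g : Y \<rightarrow> Z\<close>.\<close>

record ('o, 'm) category =
  Obj :: "'o set"
  Hom :: "'o \<Rightarrow> 'o \<Rightarrow> 'm set"
  Ide :: "'o \<Rightarrow> 'm"
  Comp :: "'o \<Rightarrow> 'o \<Rightarrow> 'o \<Rightarrow> 'm \<Rightarrow> 'm \<Rightarrow> 'm"

definition is_category :: "('o, 'm) category \<Rightarrow> bool" where
  "is_category C \<longleftrightarrow>
    (\<forall>X\<in>Obj C. Ide C X \<in> Hom C X X) \<and>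
    (\<forall>X\<in>Obj C. \<forall>Y\<in>Obj C. \<forall>Z\<in>Obj C. \<forall>f\<in>Hom C X Y. \<forall>g\<in>Hom C Y Z.
       Comp C X Y Z g f \<in> Hom C X Z) \<and>
    (\<forall>X\<in>Obj C. \<forall>Y\<in>Obj C. \<forall>f\<in>Hom C X Y.
       Comp C X X Y f (Ide C X) = f \<and> Comp C X Y Y (Ide C Y) f = f) \<and>
    (\<forall>W\<in>Obj C. \<forall>X\<in>Obj C. \<forall>Y\<in>Obj C. \<forall>Z\<in>Obj C.
       \<forall>f\<in>Hom C W X. \<forall>g\<in>Hom C X Y. \<forall>h\<in>Hom C Y Z.
       Comp C W Y Z h (Comp C W X Y g f) = Comp C W X Z (Comp C X Y Z h g) f)"

definition is_functor ::
  "('o, 'm) category \<Rightarrow> ('p, 'n) category \<Rightarrow> ('o \<Rightarrow> 'p) \<Rightarrow> ('o \<Rightarrow> 'o \<Rightarrow> 'm \<Rightarrow> 'n) \<Rightarrow> bool"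
where
  "is_functor C D Fo Fm \<longleftrightarrow>
    (\<forall>X\<in>Obj C. Fo X \<in> Obj D) \<and>
    (\<forall>X\<in>Obj C. \<forall>Y\<in>Obj C. \<forall>f\<in>Hom C X Y. Fm X Y f \<in> Hom D (Fo X) (Fo Y)) \<and>
    (\<forall>X\<in>Obj C. Fm X X (Ide C X) = Ide D (Fo X)) \<and>
    (\<forall>X\<in>Obj C. \<forall>Y\<in>Obj C. \<forall>Z\<in>Obj C. \<forall>f\<in>Hom C X Y. \<forall>g\<in>Hom C Y Z.
       Fm X Z (Comp C X Y Z g f) = Comp D (Fo X) (Fo Y) (Fo Z) (Fm Y Z g) (Fm X Y f))"

definition is_iso :: "('o, 'm) category \<Rightarrow> 'o \<Rightarrow> 'o \<Rightarrow> 'm \<Rightarrow> bool" where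
  "is_iso C X Y f \<longleftrightarrow> f \<in> Hom C X Y \<and>
    (\<exists>g\<in>Hom C Y X. Comp C X Y X g f = Ide C X \<and> Comp C Y X Y f g = Ide C Y)"

text \<open>\<open>\<eta>\<close> is a natural isomorphism from the functor \<open>(Fo, Fm)\<close> to the functor \<open>(Go, Gm)\<close>,
  both going from \<open>C\<close> to \<open>D\<close>.\<close>

definition is_natural_iso ::
  "('o, 'm) category \<Rightarrow> ('p, 'n) category \<Rightarrow>
   ('o \<Rightarrow> 'p) \<Rightarrow> ('o \<Rightarrow> 'o \<Rightarrow> 'm \<Rightarrow> 'n) \<Rightarrow>
   ('o \<Rightarrow> 'p) \<Rightarrow> ('o \<Rightarrow> 'o \<Rightarrow> 'm \<Rightarrow> 'n) \<Rightarrow> ('o \<Rightarrow> 'n) \<Rightarrow> bool"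
where
  "is_natural_iso C D Fo Fm Go Gm \<eta> \<longleftrightarrow>
    (\<forall>X\<in>Obj C. is_iso D (Fo X) (Go X) (\<eta> X)) \<and>
    (\<forall>X\<in>Obj C. \<forall>Y\<in>Obj C. \<forall>f\<in>Hom C X Y.
       Comp D (Fo X) (Fo Y) (Go Y) (\<eta> Y) (Fm X Y f)
       = Comp D (Fo X) (Go X) (Go Y) (Gm X Y f) (\<eta> X))"

definition is_equivalence ::
  "('o, 'm) category \<Rightarrow> ('p, 'n) category \<Rightarrow> ('o \<Rightarrow> 'p) \<Rightarrow> ('o \<Rightarrow> 'o \<Rightarrow> 'm \<Rightarrow> 'n) \<Rightarrow> bool"
where
  "is_equivalence C D Fo Fm \<longleftrightarrow>
    is_category C \<and> is_category D \<and> is_functor C D Fo Fm \<and>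
    (\<exists>Go Gm \<eta> \<epsilon>. is_functor D C Go Gm \<and>
       is_natural_iso C C (\<lambda>X. X) (\<lambda>X Y f. f)
         (\<lambda>X. Go (Fo X)) (\<lambda>X Y f. Gm (Fo X) (Fo Y) (Fm X Y f)) \<eta> \<and>
       is_natural_iso D D (\<lambda>A. Fo (Go A)) (\<lambda>A B g. Fm (Go A) (Go B) (Gm A B g))
         (\<lambda>A. A) (\<lambda>A B g. g) \<epsilon>)"


section \<open>Complex vector spaces with carrier\<close>

definition complex_ring :: "complex ring" where
  "complex_ring = \<lparr>carrier = UNIV, mult = (*), one = 1, zero = 0, add = (+)\<rparr>"

text \<open>Complex vector spaces are modules over \<open>complex_ring\<close>. As usual for \<open>module\<close>, the record
  fields \<open>mult\<close> and \<open>one\<close> play no role.\<close>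

definition linear_map ::
  "(complex, 'a, 'm) module_scheme \<Rightarrow> (complex, 'b, 'n) module_scheme \<Rightarrow> ('a \<Rightarrow> 'b) \<Rightarrow> bool"
where
  "linear_map M N f \<longleftrightarrow> f \<in> carrier M \<rightarrow> carrier N \<and>
    (\<forall>x\<in>carrier M. \<forall>y\<in>carrier M. f (x \<oplus>\<^bsub>M\<^esub> y) = f x \<oplus>\<^bsub>N\<^esub> f y) \<and>
    (\<forall>c. \<forall>x\<in>carrier M. f (c \<odot>\<^bsub>M\<^esub> x) = c \<odot>\<^bsub>N\<^esub> f x)"

definition linear_span :: "(complex, 'a, 'm) module_scheme \<Rightarrow> 'a set \<Rightarrow> 'a set" where
  "linear_span M S =
    {(\<Oplus>\<^bsub>M\<^esub>j\<in>{..<n}. c j \<odot>\<^bsub>M\<^esub> s j) | (n::nat) c s. s \<in> {..<n} \<rightarrow> S}"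

text \<open>The vector space of all self-maps of the carrier with pointwise operations; maps are
  extensional, so that two of them are equal iff they agree on the carrier.\<close>

definition self_maps :: "(complex, 'a, 'm) module_scheme \<Rightarrow> (complex, 'a \<Rightarrow> 'a) module" where
  "self_maps M =
    \<lparr>carrier = carrier M \<rightarrow>\<^sub>E carrier M,
     mult = undefined, one = undefined,
     zero = (\<lambda>x\<in>carrier M. \<zero>\<^bsub>M\<^esub>),
     add = (\<lambda>f g. \<lambda>x\<in>carrier M. f x \<oplus>\<^bsub>M\<^esub> g x),
     smult = (\<lambda>c f. \<lambda>x\<in>carrier M. c \<odot>\<^bsub>M\<^esub> f x)\<rparr>"


section \<open>JB*-triples\<close>

record 'a normed_triple = "(complex, 'a) module" +
  vnorm :: "'a \<Rightarrow> real"
  tprod :: "'a \<Rightarrow> 'a \<Rightarrow> 'a \<Rightarrow> 'a"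

locale hermitian_jordan_triple = module complex_ring V
  for V :: "'a normed_triple" (structure) +
  assumes tprod_closed:
      "\<lbrakk>x \<in> carrier V; y \<in> carrier V; z \<in> carrier V\<rbrakk> \<Longrightarrow> tprod V x y z \<in> carrier V"
    and tprod_sym:
      "\<lbrakk>x \<in> carrier V; y \<in> carrier V; z \<in> carrier V\<rbrakk> \<Longrightarrow> tprod V x y z = tprod V z y x"
    and tprod_add_left:
      "\<lbrakk>x \<in> carrier V; x' \<in> carrier V; y \<in> carrier V; z \<in> carrier V\<rbrakk> \<Longrightarrow>
       tprod V (x \<oplus>\<^bsub>V\<^esub> x') y z = tprod V x y z \<oplus>\<^bsub>V\<^esub> tprod V x' y z"
    and tprod_smult_left:
      "\<lbrakk>x \<in> carrier V; y \<in> carrier V; z \<in> carrier V\<rbrakk> \<Longrightarrow>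
       tprod V (c \<odot>\<^bsub>V\<^esub> x) y z = c \<odot>\<^bsub>V\<^esub> tprod V x y z"
    and tprod_add_mid:
      "\<lbrakk>x \<in> carrier V; y \<in> carrier V; y' \<in> carrier V; z \<in> carrier V\<rbrakk> \<Longrightarrow>
       tprod V x (y \<oplus>\<^bsub>V\<^esub> y') z = tprod V x y z \<oplus>\<^bsub>V\<^esub> tprod V x y' z"
    and tprod_smult_mid:
      "\<lbrakk>x \<in> carrier V; y \<in> carrier V; z \<in> carrier V\<rbrakk> \<Longrightarrow>
       tprod V x (c \<odot>\<^bsub>V\<^esub> y) z = cnj c \<odot>\<^bsub>V\<^esub> tprod V x y z"
    and jordan_identity:
      "\<lbrakk>a \<in> carrier V; b \<in> carrier V; x \<in> carrier V; y \<in> carrier V; z \<in> carrier V\<rbrakk> \<Longrightarrow>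
       tprod V a b (tprod V x y z)
       = tprod V (tprod V a b x) y z \<ominus>\<^bsub>V\<^esub> tprod V x (tprod V b a y) z
         \<oplus>\<^bsub>V\<^esub> tprod V x y (tprod V a b z)"

definition box_op :: "'a normed_triple \<Rightarrow> 'a \<Rightarrow> 'a \<Rightarrow> 'a \<Rightarrow> 'a" where
  "box_op V a b = (\<lambda>x\<in>carrier V. tprod V a b x)"

text \<open>\<open>Metric_space\<close> demands nonnegativity and symmetry on the whole type, hence the guard.\<close>

definition vdist :: "'a normed_triple \<Rightarrow> 'a \<Rightarrow> 'a \<Rightarrow> real" where
  "vdist V x y = (if x \<in> carrier V \<and> y \<in> carrier V then vnorm V (x \<ominus>\<^bsub>V\<^esub> y) else 0)"

abbreviation vtopology :: "'a normed_triple \<Rightarrow> 'a topology" where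
  "vtopology V \<equiv> Metric_space.mtopology (carrier V) (vdist V)"

definition bounded_operator :: "'a normed_triple \<Rightarrow> ('a \<Rightarrow> 'a) \<Rightarrow> bool" where
  "bounded_operator V T \<longleftrightarrow> linear_map V V T \<and>
    (\<exists>K. \<forall>x\<in>carrier V. vnorm V (T x) \<le> K * vnorm V x)"

definition operator_norm :: "'a normed_triple \<Rightarrow> ('a \<Rightarrow> 'a) \<Rightarrow> real" where
  "operator_norm V T = (SUP x\<in>{x\<in>carrier V. vnorm V x \<le> 1}. vnorm V (T x))"

definition spectrum :: "'a normed_triple \<Rightarrow> ('a \<Rightarrow> 'a) \<Rightarrow> complex set" where
  "spectrum V T = {c. \<not> (\<exists>S. bounded_operator V S \<and>
     (\<forall>x\<in>carrier V. S (T x \<ominus>\<^bsub>V\<^esub> c \<odot>\<^bsub>V\<^esub> x) = x \<and> T (S x) \<ominus>\<^bsub>V\<^esub> c \<odot>\<^bsub>V\<^esub> S x = x))}"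

definition bounded_functional :: "'a normed_triple \<Rightarrow> ('a \<Rightarrow> complex) \<Rightarrow> bool" where
  "bounded_functional V f \<longleftrightarrow>
    (\<forall>x\<in>carrier V. \<forall>y\<in>carrier V. f (x \<oplus>\<^bsub>V\<^esub> y) = f x + f y) \<and>
    (\<forall>c. \<forall>x\<in>carrier V. f (c \<odot>\<^bsub>V\<^esub> x) = c * f x) \<and>
    (\<exists>K. \<forall>x\<in>carrier V. cmod (f x) \<le> K * vnorm V x)"

definition functional_norm :: "'a normed_triple \<Rightarrow> ('a \<Rightarrow> complex) \<Rightarrow> real" where
  "functional_norm V f = (SUP x\<in>{x\<in>carrier V. vnorm V x \<le> 1}. cmod (f x))"

definition numerical_range :: "'a normed_triple \<Rightarrow> ('a \<Rightarrow> 'a) \<Rightarrow> complex set" where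
  "numerical_range V T =
    {f (T x) | f x. bounded_functional V f \<and> x \<in> carrier V \<and>
       vnorm V x = 1 \<and> functional_norm V f = 1 \<and> f x = 1}"

text \<open>A bounded operator on a complex Banach space is Hermitian if its numerical range is real.\<close>

definition hermitian_operator :: "'a normed_triple \<Rightarrow> ('a \<Rightarrow> 'a) \<Rightarrow> bool" where
  "hermitian_operator V T \<longleftrightarrow> bounded_operator V T \<and> numerical_range V T \<subseteq> \<real>"

locale jb_triple = hermitian_jordan_triple V for V :: "'a normed_triple" (structure) +
  assumes vnorm_nonneg: "x \<in> carrier V \<Longrightarrow> 0 \<le> vnorm V x"
    and vnorm_zero_iff: "x \<in> carrier V \<Longrightarrow> vnorm V x = 0 \<longleftrightarrow> x = \<zero>\<^bsub>V\<^esub>"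
    and vnorm_smult: "x \<in> carrier V \<Longrightarrow> vnorm V (c \<odot>\<^bsub>V\<^esub> x) = cmod c * vnorm V x"
    and vnorm_triangle:
      "\<lbrakk>x \<in> carrier V; y \<in> carrier V\<rbrakk> \<Longrightarrow> vnorm V (x \<oplus>\<^bsub>V\<^esub> y) \<le> vnorm V x + vnorm V y"
    and complete: "Metric_space.mcomplete (carrier V) (vdist V)"
    and tprod_continuous:
      "continuous_map (prod_topology (vtopology V) (prod_topology (vtopology V) (vtopology V)))
         (vtopology V) (\<lambda>(x, y, z). tprod V x y z)"
    and box_hermitian: "a \<in> carrier V \<Longrightarrow> hermitian_operator V (box_op V a a)"
    and box_spectrum: "a \<in> carrier V \<Longrightarrow> spectrum V (box_op V a a) \<subseteq> \<real>\<^sub>\<ge>\<^sub>0"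
    and box_norm: "a \<in> carrier V \<Longrightarrow> operator_norm V (box_op V a a) = (vnorm V a)\<^sup>2"

text \<open>Triple isomorphisms are extensional on the carrier of the domain; they are not required to
  preserve the norm.\<close>

definition triple_isos :: "'a normed_triple \<Rightarrow> 'a normed_triple \<Rightarrow> ('a \<Rightarrow> 'a) set" where
  "triple_isos V W =
    {\<phi> \<in> extensional (carrier V). bij_betw \<phi> (carrier V) (carrier W) \<and> linear_map V W \<phi> \<and>
      (\<forall>x\<in>carrier V. \<forall>y\<in>carrier V. \<forall>z\<in>carrier V.
         \<phi> (tprod V x y z) = tprod W (\<phi> x) (\<phi> y) (\<phi> z))}"

text \<open>The carriers of the objects are arbitrary subsets of the (arbitrary) type \<open>'a\<close>.\<close>

definition JB_category :: "('a normed_triple, 'a \<Rightarrow> 'a) category" where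
  "JB_category =
    \<lparr>Obj = {V. jb_triple V},
     Hom = triple_isos,
     Ide = (\<lambda>V. \<lambda>x\<in>carrier V. x),
     Comp = (\<lambda>U V W g f. compose (carrier U) g f)\<rparr>"


section \<open>Tits--Kantor--Koecher Lie algebras\<close>

record 'b graded_lie = "(complex, 'b) module" +
  bracket :: "'b \<Rightarrow> 'b \<Rightarrow> 'b"
  invol :: "'b \<Rightarrow> 'b"
  component :: "int \<Rightarrow> 'b set"

definition box_span :: "'a normed_triple \<Rightarrow> ('a \<Rightarrow> 'a) set" where
  "box_span V =
    linear_span (self_maps V) {box_op V a b | a b. a \<in> carrier V \<and> b \<in> carrier V}"

text \<open>The operation \<open>h \<mapsto> h\<^sup>\<natural>\<close>. That the value does not depend on the
  representation of \<open>h\<close> as a sum of box operators is a fact about JB*-triples.\<close>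

definition sharp :: "'a normed_triple \<Rightarrow> ('a \<Rightarrow> 'a) \<Rightarrow> 'a \<Rightarrow> 'a" where
  "sharp V h = (THE k. \<exists>(n::nat) a b.
     a \<in> {..<n} \<rightarrow> carrier V \<and> b \<in> {..<n} \<rightarrow> carrier V \<and>
     h = (\<Oplus>\<^bsub>self_maps V\<^esub>j\<in>{..<n}. box_op V (a j) (b j)) \<and>
     k = (\<Oplus>\<^bsub>self_maps V\<^esub>j\<in>{..<n}. box_op V (b j) (a j)))"

text \<open>In the third summand, the conjugate of \<open>V\<close>, the scalar \<open>c\<close> acts as \<open>cnj c\<close> does on \<open>V\<close>.\<close>

definition TKK :: "'a normed_triple \<Rightarrow> ('a \<times> ('a \<Rightarrow> 'a) \<times> 'a) graded_lie" where
  "TKK V =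
    \<lparr>carrier = carrier V \<times> box_span V \<times> carrier V,
     mult = undefined, one = undefined,
     zero = (\<zero>\<^bsub>V\<^esub>, \<zero>\<^bsub>self_maps V\<^esub>, \<zero>\<^bsub>V\<^esub>),
     add = (\<lambda>(x, h, y) (u, k, v). (x \<oplus>\<^bsub>V\<^esub> u, h \<oplus>\<^bsub>self_maps V\<^esub> k, y \<oplus>\<^bsub>V\<^esub> v)),
     smult = (\<lambda>c (x, h, y). (c \<odot>\<^bsub>V\<^esub> x, c \<odot>\<^bsub>self_maps V\<^esub> h, cnj c \<odot>\<^bsub>V\<^esub> y)),
     bracket = (\<lambda>(x, h, y) (u, k, v).
       (h u \<ominus>\<^bsub>V\<^esub> k x,
        (compose (carrier V) h k \<ominus>\<^bsub>self_maps V\<^esub> compose (carrier V) k h)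
          \<oplus>\<^bsub>self_maps V\<^esub> box_op V x v \<ominus>\<^bsub>self_maps V\<^esub> box_op V u y,
        sharp V k y \<ominus>\<^bsub>V\<^esub> sharp V h v)),
     invol = (\<lambda>(x, h, y). (y, \<ominus>\<^bsub>self_maps V\<^esub> sharp V h, x)),
     component = (\<lambda>j.
       if j = - 1 then carrier V \<times> {\<zero>\<^bsub>self_maps V\<^esub>} \<times> {\<zero>\<^bsub>V\<^esub>}
       else if j = 0 then {\<zero>\<^bsub>V\<^esub>} \<times> box_span V \<times> {\<zero>\<^bsub>V\<^esub>}
       else if j = 1 then {\<zero>\<^bsub>V\<^esub>} \<times> {\<zero>\<^bsub>self_maps V\<^esub>} \<times> carrier V
       else {(\<zero>\<^bsub>V\<^esub>, \<zero>\<^bsub>self_maps V\<^esub>, \<zero>\<^bsub>V\<^esub>)})\<rparr>"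

definition graded_invol_isos :: "'b graded_lie \<Rightarrow> 'b graded_lie \<Rightarrow> ('b \<Rightarrow> 'b) set" where
  "graded_invol_isos A B =
    {T \<in> extensional (carrier A). bij_betw T (carrier A) (carrier B) \<and> linear_map A B T \<and>
      (\<forall>p\<in>carrier A. \<forall>q\<in>carrier A. T (bracket A p q) = bracket B (T p) (T q)) \<and>
      (\<forall>j\<in>{- 1, 0, 1}. T ` component A j \<subseteq> component B j) \<and>
      (\<forall>p\<in>carrier A. T (invol A p) = invol B (T p))}"

text \<open>Objects are the graded involutive Lie algebras arising from JB*-triples; they do not
  carry the norm of the triple.\<close>

definition TKK_category ::
  "(('a \<times> ('a \<Rightarrow> 'a) \<times> 'a) graded_lie, 'a \<times> ('a \<Rightarrow> 'a) \<times> 'a \<Rightarrow> 'a \<times> ('a \<Rightarrow> 'a) \<times> 'a) category"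
where
  "TKK_category =
    \<lparr>Obj = {TKK V | V. jb_triple V},
     Hom = graded_invol_isos,
     Ide = (\<lambda>A. \<lambda>p\<in>carrier A. p),
     Comp = (\<lambda>A B C g f. compose (carrier A) g f)\<rparr>"

definition TKK_map ::
  "'a normed_triple \<Rightarrow> 'a normed_triple \<Rightarrow> ('a \<Rightarrow> 'a) \<Rightarrow>
   'a \<times> ('a \<Rightarrow> 'a) \<times> 'a \<Rightarrow> 'a \<times> ('a \<Rightarrow> 'a) \<times> 'a"
where
  "TKK_map V W \<phi> = (\<lambda>(x, h, y)\<in>carrier (TKK V).
     (\<phi> x, (\<lambda>w\<in>carrier W. \<phi> (h (inv_into (carrier V) \<phi> w))), \<phi> y))"

end

theory Submission
  imports Defs
begin

text \<open>
  The functor is surjective on objects by definition of the target category, so it is an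
  equivalence as soon as it is bijective on hom sets (\<open>is_equivalence_if_fully_faithful\<close>). An
  object of the target is given without the triple it was built from, so the inverse functor has to
  choose one; the unit is then the preimage of an identity map.

  Everything depends on \<open>h \<mapsto> h\<^sup>\<natural>\<close> being well defined. By the Jordan identity, the operator \<open>k\<close>
  obtained from any presentation of \<open>h\<close> satisfies
  \<open>h {x, y, z} = {h x, y, z} - {x, k y, z} + {x, y, h z}\<close> (\<open>jordan_adjoint\<close>). This determines \<open>k\<close>:
  the difference \<open>w\<close> of two solutions at a point satisfies \<open>{x, w, z} = 0\<close> for all \<open>x, z\<close>, so
  \<open>w \<box> w = 0\<close>, and \<open>w = 0\<close> by the norm axiom for \<open>w \<box> w\<close>. Since the characterisation only involves the
  triple product, it also shows that \<open>h \<mapsto> h\<^sup>\<natural>\<close> commutes with conjugation by triple isomorphisms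
  (\<open>sharp_conjugate\<close>), which is what makes \<open>F \<phi>\<close> a morphism (\<open>TKK_map_mem\<close>).

  The functor is faithful because \<open>F \<phi>\<close> restricts to \<open>\<phi>\<close> in degree \<open>-1\<close>. It is full because a
  graded isomorphism that commutes with the involutions is determined by its restriction \<open>\<phi>\<close> to
  degree \<open>-1\<close>: the involution gives degree \<open>1\<close>, and the brackets with degree \<open>-1\<close> give degree \<open>0\<close> and
  show that \<open>\<phi>\<close> preserves the triple product (\<open>graded_invol_iso_is_TKK_map\<close>).
\<close>

section \<open>Equivalences of categories\<close>

lemma is_category_Ide: "is_category C \<Longrightarrow> X \<in> Obj C \<Longrightarrow> Ide C X \<in> Hom C X X"
  by (simp add: is_category_def)

lemma is_category_Comp:
  "\<lbrakk>is_category C; X \<in> Obj C; Y \<in> Obj C; Z \<in> Obj C; f \<in> Hom C X Y; g \<in> Hom C Y Z\<rbrakk>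
   \<Longrightarrow> Comp C X Y Z g f \<in> Hom C X Z"
  by (simp add: is_category_def)

lemma is_category_Comp_Ide:
  "\<lbrakk>is_category C; X \<in> Obj C; Y \<in> Obj C; f \<in> Hom C X Y\<rbrakk> \<Longrightarrow> Comp C X X Y f (Ide C X) = f"
  "\<lbrakk>is_category C; X \<in> Obj C; Y \<in> Obj C; f \<in> Hom C X Y\<rbrakk> \<Longrightarrow> Comp C X Y Y (Ide C Y) f = f"
  by (simp_all add: is_category_def)

lemma is_functor_Obj: "is_functor C D Fo Fm \<Longrightarrow> X \<in> Obj C \<Longrightarrow> Fo X \<in> Obj D"
  by (simp add: is_functor_def)

lemma is_functor_Hom:
  "\<lbrakk>is_functor C D Fo Fm; X \<in> Obj C; Y \<in> Obj C; f \<in> Hom C X Y\<rbrakk>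
   \<Longrightarrow> Fm X Y f \<in> Hom D (Fo X) (Fo Y)"
  by (simp add: is_functor_def)

lemma is_functor_Ide: "is_functor C D Fo Fm \<Longrightarrow> X \<in> Obj C \<Longrightarrow> Fm X X (Ide C X) = Ide D (Fo X)"
  by (simp add: is_functor_def)

lemma is_functor_Comp:
  "\<lbrakk>is_functor C D Fo Fm; X \<in> Obj C; Y \<in> Obj C; Z \<in> Obj C; f \<in> Hom C X Y; g \<in> Hom C Y Z\<rbrakk>
   \<Longrightarrow> Fm X Z (Comp C X Y Z g f) = Comp D (Fo X) (Fo Y) (Fo Z) (Fm Y Z g) (Fm X Y f)"
  by (simp add: is_functor_def)

text \<open>Choose for every object \<open>A\<close> of \<open>D\<close> a preimage \<open>G A\<close>, and for every morphism its preimage under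
  the bijection on hom sets. As \<open>F G A = A\<close> holds on the nose, the counit is the identity, and the
  unit at \<open>X\<close> is the preimage of the identity of \<open>F X = F G F X\<close>.\<close>

lemma is_equivalence_if_fully_faithful:
  assumes C: "is_category C" and D: "is_category D" and F: "is_functor C D Fo Fm"
    and bij: "\<And>X Y. X \<in> Obj C \<Longrightarrow> Y \<in> Obj C \<Longrightarrow>
      bij_betw (Fm X Y) (Hom C X Y) (Hom D (Fo X) (Fo Y))"
    and surj: "Obj D \<subseteq> Fo ` Obj C"
  shows "is_equivalence C D Fo Fm"
proof -
  note cat = is_category_Ide[OF C] is_category_Comp[OF C] is_category_Ide[OF D]
    is_category_Comp[OF D] is_category_Comp_Ide[OF C] is_category_Comp_Ide[OF D]
    is_functor_Obj[OF F] is_functor_Hom[OF F] is_functor_Ide[OF F] is_functor_Comp[OF F]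
  define Go where "Go A = inv_into (Obj C) Fo A" for A
  define P where "P X Y g = inv_into (Hom C X Y) (Fm X Y) g" for X Y g
  define Gm where "Gm A B = P (Go A) (Go B)" for A B
  have Go: "Go A \<in> Obj C" "Fo (Go A) = A" if "A \<in> Obj D" for A
    using surj that by (auto simp: Go_def inv_into_into f_inv_into_f)
  have faithful: "f = f'" if "X \<in> Obj C" "Y \<in> Obj C" "f \<in> Hom C X Y" "f' \<in> Hom C X Y"
      "Fm X Y f = Fm X Y f'" for X Y f f'
    using bij[OF that(1,2)] that by (meson bij_betw_imp_inj_on inj_onD)
  have P: "P X Y g \<in> Hom C X Y" "Fm X Y (P X Y g) = g"
    if "X \<in> Obj C" "Y \<in> Obj C" "g \<in> Hom D (Fo X) (Fo Y)" for X Y g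
    using bij[OF that(1,2)] that(3) unfolding P_def
    by (auto simp: bij_betw_def inv_into_into f_inv_into_f)
  have Gm: "Gm A B g \<in> Hom C (Go A) (Go B)" "Fm (Go A) (Go B) (Gm A B g) = g"
    if "A \<in> Obj D" "B \<in> Obj D" "g \<in> Hom D A B" for A B g
    using P[of "Go A" "Go B" g] that by (simp_all add: Go Gm_def)
  have G: "is_functor D C Go Gm"
    unfolding is_functor_def
  proof (intro conjI ballI)
    fix A assume A: "A \<in> Obj D"
    show "Gm A A (Ide D A) = Ide C (Go A)"
      by (rule faithful[of "Go A" "Go A"]) (simp_all add: A Go Gm cat)
  next
    fix A B K f g
    assume *: "A \<in> Obj D" "B \<in> Obj D" "K \<in> Obj D" "f \<in> Hom D A B" "g \<in> Hom D B K"
    have [simp]: "Gm A B f \<in> Hom C (Go A) (Go B)" "Gm B K g \<in> Hom C (Go B) (Go K)"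
      "Comp D A B K g f \<in> Hom D A K"
      by (auto intro: Gm * cat(4)[of A B K])
    have [simp]: "Comp C (Go A) (Go B) (Go K) (Gm B K g) (Gm A B f) \<in> Hom C (Go A) (Go K)"
      by (rule cat) (simp_all add: * Go)
    show "Gm A K (Comp D A B K g f) = Comp C (Go A) (Go B) (Go K) (Gm B K g) (Gm A B f)"
      by (rule faithful[of "Go A" "Go K"]) (simp_all add: * Go Gm cat(12)[of _ "Go B"])
  qed (simp_all add: Go Gm)
  \<comment> \<open>the component of the unit at X and its inverse, both lying over the identity of F X\<close>
  define \<eta> where "\<eta> X = P X (Go (Fo X)) (Ide D (Fo X))" for X
  define \<theta> where "\<theta> X = P (Go (Fo X)) X (Ide D (Fo X))" for X
  have \<eta>: "\<eta> X \<in> Hom C X (Go (Fo X))" "Fm X (Go (Fo X)) (\<eta> X) = Ide D (Fo X)"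
    and \<theta>: "\<theta> X \<in> Hom C (Go (Fo X)) X" "Fm (Go (Fo X)) X (\<theta> X) = Ide D (Fo X)"
    if "X \<in> Obj C" for X
    unfolding \<eta>_def \<theta>_def by (rule P; simp add: that Go cat)+
  have unit: "is_natural_iso C C (\<lambda>X. X) (\<lambda>X Y f. f)
         (\<lambda>X. Go (Fo X)) (\<lambda>X Y f. Gm (Fo X) (Fo Y) (Fm X Y f)) \<eta>"
    unfolding is_natural_iso_def
  proof (intro conjI ballI)
    fix X assume X: "X \<in> Obj C"
    let ?G = "Go (Fo X)"
    have [simp]: "Fo X \<in> Obj D" "?G \<in> Obj C" "Fo ?G = Fo X" using X by (simp_all add: Go cat)
    have [simp]: "Comp D (Fo X) (Fo X) (Fo X) (Ide D (Fo X)) (Ide D (Fo X)) = Ide D (Fo X)"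
      by (rule cat) (simp_all add: cat)
    have "Comp C X ?G X (\<theta> X) (\<eta> X) = Ide C X"
      by (rule faithful[of X X])
         (use X in \<open>simp_all add: \<eta> \<theta> cat(1,9,11) cat(2)[of X ?G X] cat(12)[of X ?G X]\<close>)
    moreover have "Comp C ?G X ?G (\<eta> X) (\<theta> X) = Ide C ?G"
      by (rule faithful[of ?G ?G])
         (use X in \<open>simp_all add: \<eta> \<theta> cat(1,9,11) cat(2)[of ?G X ?G] cat(12)[of ?G X ?G]\<close>)
    ultimately show "is_iso C X ?G (\<eta> X)"
      using \<eta> \<theta> X unfolding is_iso_def by blast
  next
    fix X Y f assume X: "X \<in> Obj C" "Y \<in> Obj C" "f \<in> Hom C X Y"
    let ?g = "Gm (Fo X) (Fo Y) (Fm X Y f)"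
    have [simp]: "Fo X \<in> Obj D" "Go (Fo X) \<in> Obj C" "Fo (Go (Fo X)) = Fo X"
       "Fo Y \<in> Obj D" "Go (Fo Y) \<in> Obj C" "Fo (Go (Fo Y)) = Fo Y"
      using X by (simp_all add: Go cat)
    have [simp]: "Fm X Y f \<in> Hom D (Fo X) (Fo Y)" using X by (simp add: cat)
    have [simp]: "?g \<in> Hom C (Go (Fo X)) (Go (Fo Y))"
       "Fm (Go (Fo X)) (Go (Fo Y)) ?g = Fm X Y f" by (simp_all add: Gm)
    show "Comp C X Y (Go (Fo Y)) (\<eta> Y) f = Comp C X (Go (Fo X)) (Go (Fo Y)) ?g (\<eta> X)"
      by (rule faithful[of X "Go (Fo Y)"])
         (use X in \<open>simp_all add: \<eta> cat(2)[of X Y] cat(2)[of X "Go (Fo X)"]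
            cat(12)[of X Y] cat(12)[of X "Go (Fo X)"] cat(7,8)\<close>)
  qed
  have counit: "is_natural_iso D D (\<lambda>A. Fo (Go A)) (\<lambda>A B g. Fm (Go A) (Go B) (Gm A B g))
         (\<lambda>A. A) (\<lambda>A B g. g) (Ide D)"
    unfolding is_natural_iso_def is_iso_def
    by (auto simp: Go Gm cat(7,8) cat(3) intro!: bexI[of _ "Ide D _"])
  show ?thesis
    unfolding is_equivalence_def using C D F G unit counit by blast
qed

section \<open>Complex vector spaces\<close>

lemma complex_ring_simps [simp]:
  "carrier complex_ring = UNIV" "\<one>\<^bsub>complex_ring\<^esub> = 1" "\<zero>\<^bsub>complex_ring\<^esub> = 0"
  "c \<otimes>\<^bsub>complex_ring\<^esub> d = c * d" "c \<oplus>\<^bsub>complex_ring\<^esub> d = c + d"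
  by (simp_all add: complex_ring_def)

lemma uminus_eq_smult:
  assumes "module complex_ring M" "x \<in> carrier M"
  shows "\<ominus>\<^bsub>M\<^esub> x = (- 1) \<odot>\<^bsub>M\<^esub> x"
proof -
  interpret module complex_ring M by fact
  have "(- 1) \<odot>\<^bsub>M\<^esub> x \<oplus>\<^bsub>M\<^esub> x = (- 1 + 1) \<odot>\<^bsub>M\<^esub> x"
    using smult_l_distr[of "-1" 1 x] smult_one[of x] assms(2) by simp
  also have "\<dots> = \<zero>\<^bsub>M\<^esub>"
    using smult_l_null[of x] assms(2) by simp
  finally show ?thesis
    using M.minus_equality[of "(- 1) \<odot>\<^bsub>M\<^esub> x" x] smult_closed[of "-1" x] assms(2) by simp
qed

lemma linear_mapD:
  assumes "linear_map M N f"
  shows linear_map_closed: "x \<in> carrier M \<Longrightarrow> f x \<in> carrier N"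
    and linear_map_add: "\<lbrakk>x \<in> carrier M; y \<in> carrier M\<rbrakk> \<Longrightarrow> f (x \<oplus>\<^bsub>M\<^esub> y) = f x \<oplus>\<^bsub>N\<^esub> f y"
    and linear_map_smult: "x \<in> carrier M \<Longrightarrow> f (c \<odot>\<^bsub>M\<^esub> x) = c \<odot>\<^bsub>N\<^esub> f x"
  using assms by (auto simp: linear_map_def)

lemma linear_map_zero:
  assumes "module complex_ring M" "module complex_ring N" "linear_map M N f"
  shows "f \<zero>\<^bsub>M\<^esub> = \<zero>\<^bsub>N\<^esub>"
proof -
  interpret M: module complex_ring M by fact
  interpret N: module complex_ring N by fact
  have 0: "\<zero>\<^bsub>M\<^esub> \<in> carrier M" by (rule M.M.zero_closed)
  have "f (0 \<odot>\<^bsub>M\<^esub> \<zero>\<^bsub>M\<^esub>) = 0 \<odot>\<^bsub>N\<^esub> f \<zero>\<^bsub>M\<^esub>"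
    by (rule linear_map_smult[OF assms(3) 0])
  then show ?thesis
    using M.smult_l_null[OF 0] N.smult_l_null[OF linear_map_closed[OF assms(3) 0]] by simp
qed

lemma linear_map_minus:
  assumes "module complex_ring M" "module complex_ring N" "linear_map M N f"
    and "x \<in> carrier M" "y \<in> carrier M"
  shows "f (x \<ominus>\<^bsub>M\<^esub> y) = f x \<ominus>\<^bsub>N\<^esub> f y"
proof -
  interpret M: module complex_ring M by fact
  have "(- 1) \<odot>\<^bsub>M\<^esub> y \<in> carrier M" using M.smult_closed[of "-1" y] assms by simp
  then show ?thesis
    using assms by (simp add: a_minus_def uminus_eq_smult linear_mapD[OF assms(3)])
qed

subsection \<open>Spaces of maps\<close>

lemma carrier_self_maps: "carrier (self_maps M) = carrier M \<rightarrow>\<^sub>E carrier M"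
  by (simp add: self_maps_def)

lemma self_maps_apply_closed: "f \<in> carrier (self_maps M) \<Longrightarrow> x \<in> carrier M \<Longrightarrow> f x \<in> carrier M"
  by (auto simp: carrier_self_maps)

lemma self_maps_apply [simp]:
  "x \<in> carrier M \<Longrightarrow> \<zero>\<^bsub>self_maps M\<^esub> x = \<zero>\<^bsub>M\<^esub>"
  "x \<in> carrier M \<Longrightarrow> (f \<oplus>\<^bsub>self_maps M\<^esub> g) x = f x \<oplus>\<^bsub>M\<^esub> g x"
  "x \<in> carrier M \<Longrightarrow> (c \<odot>\<^bsub>self_maps M\<^esub> f) x = c \<odot>\<^bsub>M\<^esub> f x"
  by (simp_all add: self_maps_def)

text \<open>Extensionality of the maps reduces identities between operators to their values on the carrier;
  all such identities below are proved pointwise in this way.\<close>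

lemma self_maps_eqI:
  "\<lbrakk>f \<in> carrier (self_maps M); g \<in> carrier (self_maps M); \<And>x. x \<in> carrier M \<Longrightarrow> f x = g x\<rbrakk>
   \<Longrightarrow> f = g"
  by (auto simp: carrier_self_maps intro: PiE_ext)

lemma module_self_maps:
  assumes "module complex_ring M"
  shows "module complex_ring (self_maps M)"
proof -
  interpret module complex_ring M by fact
  note sc = smult_closed[simplified]
  have add: "f \<oplus>\<^bsub>self_maps M\<^esub> g \<in> carrier (self_maps M)"
    if "f \<in> carrier (self_maps M)" "g \<in> carrier (self_maps M)" for f g
    using that by (auto simp: self_maps_def)
  have zero: "\<zero>\<^bsub>self_maps M\<^esub> \<in> carrier (self_maps M)"
    by (auto simp: self_maps_def)
  have smult: "c \<odot>\<^bsub>self_maps M\<^esub> f \<in> carrier (self_maps M)"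
    if "f \<in> carrier (self_maps M)" for c f
    using that by (auto simp: self_maps_def intro!: sc)
  note closed = add zero smult
  show ?thesis
  proof (rule moduleI)
    show "cring complex_ring" by (rule R.is_cring)
    show "abelian_group (self_maps M)"
    proof (rule abelian_groupI)
      fix f assume f: "f \<in> carrier (self_maps M)"
      have neg: "(\<lambda>x\<in>carrier M. \<ominus>\<^bsub>M\<^esub> f x) \<in> carrier (self_maps M)"
        using f by (auto simp: carrier_self_maps PiE_iff)
      moreover have "(\<lambda>x\<in>carrier M. \<ominus>\<^bsub>M\<^esub> f x) \<oplus>\<^bsub>self_maps M\<^esub> f = \<zero>\<^bsub>self_maps M\<^esub>"
        by (intro self_maps_eqI[where M = M] closed neg f) (use f in \<open>auto simp: M.l_neg self_maps_apply_closed\<close>)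
      ultimately show "\<exists>g\<in>carrier (self_maps M). g \<oplus>\<^bsub>self_maps M\<^esub> f = \<zero>\<^bsub>self_maps M\<^esub>"
        by blast
    next
      fix f g h
      assume "f \<in> carrier (self_maps M)" "g \<in> carrier (self_maps M)" "h \<in> carrier (self_maps M)"
      then show "f \<oplus>\<^bsub>self_maps M\<^esub> g \<oplus>\<^bsub>self_maps M\<^esub> h = f \<oplus>\<^bsub>self_maps M\<^esub> (g \<oplus>\<^bsub>self_maps M\<^esub> h)"
        by (intro self_maps_eqI[where M = M] closed) (auto simp: M.a_assoc self_maps_apply_closed)
    next
      fix f g
      assume "f \<in> carrier (self_maps M)" "g \<in> carrier (self_maps M)"
      then show "f \<oplus>\<^bsub>self_maps M\<^esub> g = g \<oplus>\<^bsub>self_maps M\<^esub> f"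
        by (intro self_maps_eqI[where M = M] closed) (auto simp: M.a_comm self_maps_apply_closed)
    next
      fix f
      assume "f \<in> carrier (self_maps M)"
      then show "\<zero>\<^bsub>self_maps M\<^esub> \<oplus>\<^bsub>self_maps M\<^esub> f = f"
        by (intro self_maps_eqI[where M = M] closed) (auto simp: self_maps_apply_closed)
    qed (use closed in auto)
  next
    fix f g c assume f: "f \<in> carrier (self_maps M)" "g \<in> carrier (self_maps M)"
    show "c \<odot>\<^bsub>self_maps M\<^esub> (f \<oplus>\<^bsub>self_maps M\<^esub> g) = c \<odot>\<^bsub>self_maps M\<^esub> f \<oplus>\<^bsub>self_maps M\<^esub> c \<odot>\<^bsub>self_maps M\<^esub> g"
      by (intro self_maps_eqI[where M = M] closed f) (use f in \<open>auto simp: smult_r_distr self_maps_apply_closed\<close>)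
  next
    fix f c d assume f: "f \<in> carrier (self_maps M)"
    show "(c \<oplus>\<^bsub>complex_ring\<^esub> d) \<odot>\<^bsub>self_maps M\<^esub> f = c \<odot>\<^bsub>self_maps M\<^esub> f \<oplus>\<^bsub>self_maps M\<^esub> d \<odot>\<^bsub>self_maps M\<^esub> f"
      by (intro self_maps_eqI[where M = M] closed f) (use f in \<open>auto simp: smult_l_distr[simplified] self_maps_apply_closed\<close>)
    show "(c \<otimes>\<^bsub>complex_ring\<^esub> d) \<odot>\<^bsub>self_maps M\<^esub> f = c \<odot>\<^bsub>self_maps M\<^esub> (d \<odot>\<^bsub>self_maps M\<^esub> f)"
      by (intro self_maps_eqI[where M = M] closed f) (use f in \<open>auto simp: smult_assoc1[simplified] self_maps_apply_closed\<close>)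
  next
    fix f assume f: "f \<in> carrier (self_maps M)"
    show "\<one>\<^bsub>complex_ring\<^esub> \<odot>\<^bsub>self_maps M\<^esub> f = f"
      by (intro self_maps_eqI[where M = M] closed f) (use f in \<open>auto simp: smult_one[simplified] self_maps_apply_closed\<close>)
  qed (use smult in auto)
qed

lemma self_maps_minus_apply [simp]:
  assumes "module complex_ring M" "g \<in> carrier (self_maps M)" "x \<in> carrier M"
  shows "(f \<ominus>\<^bsub>self_maps M\<^esub> g) x = f x \<ominus>\<^bsub>M\<^esub> g x"
proof -
  have "g x \<in> carrier M" using assms by (simp add: self_maps_apply_closed)
  then show ?thesis
    using assms by (simp add: a_minus_def uminus_eq_smult[OF module_self_maps[OF assms(1)]]
      uminus_eq_smult[OF assms(1)])
qed

subsection \<open>Linear spans\<close>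

lemma linear_span_zero:
  "module complex_ring M \<Longrightarrow> \<zero>\<^bsub>M\<^esub> \<in> linear_span M S"
proof -
  assume "module complex_ring M"
  then interpret module complex_ring M .
  show ?thesis
    unfolding linear_span_def by (rule CollectI, rule exI[of _ 0]) simp
qed

lemma finsum_lessThan_Suc:
  assumes "module complex_ring M" "\<And>j. j < Suc n \<Longrightarrow> f j \<in> carrier M"
  shows "(\<Oplus>\<^bsub>M\<^esub>j\<in>{..<Suc n}. f j) = (\<Oplus>\<^bsub>M\<^esub>j\<in>{..<n}. f j) \<oplus>\<^bsub>M\<^esub> f n"
proof -
  interpret module complex_ring M by fact
  have "(\<Oplus>\<^bsub>M\<^esub>j\<in>insert n {..<n}. f j) = f n \<oplus>\<^bsub>M\<^esub> (\<Oplus>\<^bsub>M\<^esub>j\<in>{..<n}. f j)"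
    by (rule M.finsum_insert) (use assms in auto)
  also have "\<dots> = (\<Oplus>\<^bsub>M\<^esub>j\<in>{..<n}. f j) \<oplus>\<^bsub>M\<^esub> f n"
    by (intro M.a_comm M.finsum_closed) (use assms in auto)
  finally show ?thesis by (simp add: lessThan_Suc)
qed

lemma finsum_lessThan_snoc:
  assumes "module complex_ring M" "\<And>j. j < n \<Longrightarrow> f j \<in> carrier M" "x \<in> carrier M"
    and "\<And>j. j < n \<Longrightarrow> g j = f j" "g n = x"
  shows "(\<Oplus>\<^bsub>M\<^esub>j\<in>{..<Suc n}. g j) = (\<Oplus>\<^bsub>M\<^esub>j\<in>{..<n}. f j) \<oplus>\<^bsub>M\<^esub> x"
proof -
  interpret module complex_ring M by fact
  have "(\<Oplus>\<^bsub>M\<^esub>j\<in>{..<n}. g j) = (\<Oplus>\<^bsub>M\<^esub>j\<in>{..<n}. f j)"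
    by (rule M.finsum_cong') (use assms in auto)
  then show ?thesis
    by (subst finsum_lessThan_Suc[OF assms(1)]) (use assms in \<open>auto simp: less_Suc_eq\<close>)
qed

lemma linear_span_step:
  assumes M: "module complex_ring M" and S: "S \<subseteq> carrier M"
    and x: "x \<in> linear_span M S" and s: "s \<in> S"
  shows "x \<oplus>\<^bsub>M\<^esub> c \<odot>\<^bsub>M\<^esub> s \<in> linear_span M S"
proof -
  interpret module complex_ring M by fact
  note sc = smult_closed[simplified]
  obtain n and d :: "nat \<Rightarrow> complex" and t where t: "t \<in> {..<n} \<rightarrow> S"
    and x: "x = (\<Oplus>\<^bsub>M\<^esub>j\<in>{..<n}. d j \<odot>\<^bsub>M\<^esub> t j)"
    using x by (auto simp: linear_span_def)
  have "x \<oplus>\<^bsub>M\<^esub> c \<odot>\<^bsub>M\<^esub> s = (\<Oplus>\<^bsub>M\<^esub>j\<in>{..<Suc n}. (d(n := c)) j \<odot>\<^bsub>M\<^esub> (t(n := s)) j)"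
    unfolding x
    by (rule finsum_lessThan_snoc[OF M, symmetric]) (use t s S in \<open>auto intro!: sc\<close>)
  moreover have "t(n := s) \<in> {..<Suc n} \<rightarrow> S" using t s by (auto simp: less_Suc_eq)
  ultimately show ?thesis unfolding linear_span_def by blast
qed

text \<open>Linear combinations are built up from the empty one by adding terms at the end.\<close>

lemma linear_span_induct [consumes 3, case_names zero step]:
  assumes M: "module complex_ring M" and S: "S \<subseteq> carrier M"
    and x: "x \<in> linear_span M S"
    and zero: "P \<zero>\<^bsub>M\<^esub>"
    and step: "\<And>x c s. \<lbrakk>x \<in> linear_span M S; x \<in> carrier M; P x; s \<in> S\<rbrakk> \<Longrightarrow> P (x \<oplus>\<^bsub>M\<^esub> c \<odot>\<^bsub>M\<^esub> s)"
  shows "P x"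
proof -
  interpret module complex_ring M by fact
  note sc = smult_closed[simplified]
  have "P (\<Oplus>\<^bsub>M\<^esub>j\<in>{..<n}. c j \<odot>\<^bsub>M\<^esub> s j)"
    if "s \<in> {..<n} \<rightarrow> S" for n and c :: "nat \<Rightarrow> complex" and s
    using that
  proof (induction n)
    case (Suc n)
    have s: "s \<in> {..<n} \<rightarrow> S" using Suc.prems by auto
    let ?y = "\<Oplus>\<^bsub>M\<^esub>j\<in>{..<n}. c j \<odot>\<^bsub>M\<^esub> s j"
    have "?y \<in> carrier M"
      by (rule M.finsum_closed) (use s S in \<open>auto intro!: sc\<close>)
    moreover have "?y \<in> linear_span M S" using s unfolding linear_span_def by blast
    moreover have "s n \<in> S" using Suc.prems by auto
    ultimately have "P (?y \<oplus>\<^bsub>M\<^esub> c n \<odot>\<^bsub>M\<^esub> s n)" using step Suc.IH[OF s] by blast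
    then show ?case
      by (subst finsum_lessThan_Suc[OF M]) (use Suc.prems S in \<open>auto intro!: sc\<close>)
  qed (simp add: zero)
  then show ?thesis using x unfolding linear_span_def by blast
qed

section \<open>Box operators\<close>

lemma compose_closed:
  "\<lbrakk>f \<in> carrier (self_maps M); g \<in> carrier (self_maps M)\<rbrakk>
   \<Longrightarrow> compose (carrier M) f g \<in> carrier (self_maps M)"
  by (auto simp: compose_def carrier_self_maps)

context hermitian_jordan_triple
begin

lemma is_module: "module complex_ring V" ..

lemma smult_mem [simp]: "x \<in> carrier V \<Longrightarrow> c \<odot>\<^bsub>V\<^esub> x \<in> carrier V"
  using smult_closed by simp

sublocale End: module complex_ring "self_maps V"
  by (rule module_self_maps[OF is_module])

lemma End_smult_closed: "f \<in> carrier (self_maps V) \<Longrightarrow> c \<odot>\<^bsub>self_maps V\<^esub> f \<in> carrier (self_maps V)"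
  using End.smult_closed by simp

lemma box_op_apply [simp]: "x \<in> carrier V \<Longrightarrow> box_op V a b x = tprod V a b x"
  by (simp add: box_op_def)

lemma box_op_closed:
  "\<lbrakk>a \<in> carrier V; b \<in> carrier V\<rbrakk> \<Longrightarrow> box_op V a b \<in> carrier (self_maps V)"
  by (auto simp: box_op_def tprod_closed carrier_self_maps)

lemmas End_closed = compose_closed[of _ V] End.M.minus_closed End.M.a_closed End.M.zero_closed
  End_smult_closed End.M.a_inv_closed box_op_closed

abbreviation commutator :: "('a \<Rightarrow> 'a) \<Rightarrow> ('a \<Rightarrow> 'a) \<Rightarrow> 'a \<Rightarrow> 'a" where
  "commutator h k \<equiv> compose (carrier V) h k \<ominus>\<^bsub>self_maps V\<^esub> compose (carrier V) k h"

lemma commutator_closed: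
  "\<lbrakk>h \<in> carrier (self_maps V); k \<in> carrier (self_maps V)\<rbrakk>
   \<Longrightarrow> commutator h k \<in> carrier (self_maps V)"
  by (intro End.M.minus_closed compose_closed)

lemma commutator_apply:
  "\<lbrakk>h \<in> carrier (self_maps V); k \<in> carrier (self_maps V); x \<in> carrier V\<rbrakk>
   \<Longrightarrow> commutator h k x = h (k x) \<ominus>\<^bsub>V\<^esub> k (h x)"
  by (simp add: self_maps_minus_apply[OF is_module] compose_closed compose_eq)

text \<open>Scalars can be moved into the box operator, which is why the linear span of the box operators
  consists of plain sums of box operators.\<close>

lemma box_op_smult:
  "\<lbrakk>a \<in> carrier V; b \<in> carrier V\<rbrakk> \<Longrightarrow> c \<odot>\<^bsub>self_maps V\<^esub> box_op V a b = box_op V (c \<odot>\<^bsub>V\<^esub> a) b"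
  by (rule self_maps_eqI[where M = V]; (intro End_closed)?) (auto simp: tprod_smult_left)

lemma linear_map_tprod_right:
  "\<lbrakk>a \<in> carrier V; b \<in> carrier V\<rbrakk> \<Longrightarrow> linear_map V V (tprod V a b)"
  unfolding linear_map_def
  by (auto simp: tprod_closed tprod_sym[of a b] tprod_add_left tprod_smult_left)

lemma linear_map_tprod_left:
  "\<lbrakk>b \<in> carrier V; c \<in> carrier V\<rbrakk> \<Longrightarrow> linear_map V V (\<lambda>a. tprod V a b c)"
  unfolding linear_map_def by (auto simp: tprod_closed tprod_add_left tprod_smult_left)

lemma tprod_minus_mid:
  assumes "a \<in> carrier V" "b \<in> carrier V" "b' \<in> carrier V" "c \<in> carrier V"
  shows "tprod V a (b \<ominus>\<^bsub>V\<^esub> b') c = tprod V a b c \<ominus>\<^bsub>V\<^esub> tprod V a b' c"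
  using assms by (simp add: a_minus_def uminus_eq_smult[OF is_module] tprod_closed tprod_add_mid
    tprod_smult_mid)

lemma tprod_zero_mid:
  assumes "a \<in> carrier V" "c \<in> carrier V"
  shows "tprod V a \<zero>\<^bsub>V\<^esub> c = \<zero>\<^bsub>V\<^esub>"
  using tprod_minus_mid[of a "\<zero>\<^bsub>V\<^esub>" "\<zero>\<^bsub>V\<^esub>" c] assms tprod_closed[of a "\<zero>\<^bsub>V\<^esub>" c]
  by (simp add: M.minus_eq M.r_neg)

lemma box_ops_subset_self_maps:
  "{box_op V a b |a b. a \<in> carrier V \<and> b \<in> carrier V} \<subseteq> carrier (self_maps V)"
  using box_op_closed by blast

lemma box_span_zero: "\<zero>\<^bsub>self_maps V\<^esub> \<in> box_span V"
  unfolding box_span_def by (rule linear_span_zero) (rule End.module_axioms)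

lemma box_span_add_box:
  assumes "h \<in> box_span V" "a \<in> carrier V" "b \<in> carrier V"
  shows "h \<oplus>\<^bsub>self_maps V\<^esub> box_op V a b \<in> box_span V"
proof -
  have "h \<oplus>\<^bsub>self_maps V\<^esub> 1 \<odot>\<^bsub>self_maps V\<^esub> box_op V a b \<in> box_span V"
    unfolding box_span_def
    by (rule linear_span_step[OF End.module_axioms box_ops_subset_self_maps])
       (use assms in \<open>auto simp: box_span_def\<close>)
  then show ?thesis using End.smult_one[OF box_op_closed[OF assms(2,3)]] by simp
qed

lemma box_span_induct [consumes 1, case_names zero add_box]:
  assumes "h \<in> box_span V"
    and "P \<zero>\<^bsub>self_maps V\<^esub>"
    and "\<And>h a b. \<lbrakk>h \<in> box_span V; h \<in> carrier (self_maps V); P h; a \<in> carrier V; b \<in> carrier V\<rbrakk>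
      \<Longrightarrow> P (h \<oplus>\<^bsub>self_maps V\<^esub> box_op V a b)"
  shows "P h"
  using End.module_axioms box_ops_subset_self_maps assms(1)[unfolded box_span_def]
proof (induction rule: linear_span_induct)
  case (step h c s)
  then obtain a b where "a \<in> carrier V" "b \<in> carrier V" "s = box_op V a b" by blast
  then show ?case
    using assms(3)[of h "c \<odot>\<^bsub>V\<^esub> a" b] step by (simp add: box_span_def box_op_smult)
qed (fact assms(2))

lemma box_span_closed: "h \<in> box_span V \<Longrightarrow> h \<in> carrier (self_maps V)"
  by (induction rule: box_span_induct) (intro End_closed; assumption)+

lemma box_span_apply_closed: "h \<in> box_span V \<Longrightarrow> x \<in> carrier V \<Longrightarrow> h x \<in> carrier V"
  by (rule self_maps_apply_closed[OF box_span_closed])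

lemma box_span_add:
  assumes "h \<in> box_span V" "k \<in> box_span V"
  shows "h \<oplus>\<^bsub>self_maps V\<^esub> k \<in> box_span V"
  using assms(2)
proof (induction rule: box_span_induct)
  case zero
  then show ?case using assms(1) box_span_closed End.M.r_zero by metis
next
  case (add_box k a b)
  then show ?case
    using box_span_add_box[of "h \<oplus>\<^bsub>self_maps V\<^esub> k" a b] box_span_closed[OF assms(1)] box_op_closed
    by (metis End.M.a_assoc)
qed

lemma box_op_mem_box_span:
  "\<lbrakk>a \<in> carrier V; b \<in> carrier V\<rbrakk> \<Longrightarrow> box_op V a b \<in> box_span V"
  using box_span_add_box[OF box_span_zero] box_op_closed End.M.l_zero by metis

lemma box_span_smult:
  assumes "h \<in> box_span V"
  shows "c \<odot>\<^bsub>self_maps V\<^esub> h \<in> box_span V"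
  using assms
proof (induction rule: box_span_induct)
  case zero
  then show ?case using box_span_zero End.smult_r_null[of c] by simp
next
  case (add_box h a b)
  have "c \<odot>\<^bsub>self_maps V\<^esub> (h \<oplus>\<^bsub>self_maps V\<^esub> box_op V a b)
      = c \<odot>\<^bsub>self_maps V\<^esub> h \<oplus>\<^bsub>self_maps V\<^esub> box_op V (c \<odot>\<^bsub>V\<^esub> a) b"
    using End.smult_r_distr[of c h "box_op V a b"] add_box box_op_closed box_op_smult by simp
  then show ?case using add_box by (simp add: box_span_add_box)
qed

lemma box_span_minus:
  "\<lbrakk>h \<in> box_span V; k \<in> box_span V\<rbrakk> \<Longrightarrow> h \<ominus>\<^bsub>self_maps V\<^esub> k \<in> box_span V"
  "k \<in> box_span V \<Longrightarrow> \<ominus>\<^bsub>self_maps V\<^esub> k \<in> box_span V"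
  by (simp_all add: a_minus_def uminus_eq_smult[OF End.module_axioms box_span_closed]
      box_span_add box_span_smult)

lemma add_minus_add_distrib:
  assumes "p \<in> carrier V" "q \<in> carrier V" "r \<in> carrier V"
    and "p' \<in> carrier V" "q' \<in> carrier V" "r' \<in> carrier V"
  shows "(p \<ominus>\<^bsub>V\<^esub> q \<oplus>\<^bsub>V\<^esub> r) \<oplus>\<^bsub>V\<^esub> (p' \<ominus>\<^bsub>V\<^esub> q' \<oplus>\<^bsub>V\<^esub> r')
    = (p \<oplus>\<^bsub>V\<^esub> p') \<ominus>\<^bsub>V\<^esub> (q \<oplus>\<^bsub>V\<^esub> q') \<oplus>\<^bsub>V\<^esub> (r \<oplus>\<^bsub>V\<^esub> r')"
  using assms by (simp add: M.minus_eq M.minus_add M.a_ac)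

lemma linear_map_box_span:
  "h \<in> box_span V \<Longrightarrow> linear_map V V h"
proof (induction rule: box_span_induct)
  case zero
  then show ?case by (auto simp: linear_map_def smult_r_null[simplified])
next
  case (add_box h a b)
  have "linear_map V V (\<lambda>x. h x \<oplus>\<^bsub>V\<^esub> tprod V a b x)"
    using linear_mapD[OF add_box.IH] linear_mapD[OF linear_map_tprod_right[OF add_box.hyps(3,4)]]
    unfolding linear_map_def by (auto simp: M.a_ac smult_r_distr[simplified])
  then show ?case by (auto simp: linear_map_def)
qed

text \<open>The Jordan identity says that \<open>b \<box> a\<close> stands in this relation to \<open>a \<box> b\<close>. As the
  relation is additive, it holds between any sum of box operators and the sum of the swapped box
  operators; unlike the sums, it makes no reference to a presentation.\<close>

definition jordan_adjoint :: "('a \<Rightarrow> 'a) \<Rightarrow> ('a \<Rightarrow> 'a) \<Rightarrow> bool" where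
  "jordan_adjoint h k \<longleftrightarrow> (\<forall>x\<in>carrier V. \<forall>y\<in>carrier V. \<forall>z\<in>carrier V.
     h (tprod V x y z) = tprod V (h x) y z \<ominus>\<^bsub>V\<^esub> tprod V x (k y) z \<oplus>\<^bsub>V\<^esub> tprod V x y (h z))"

lemma jordan_adjointD:
  "\<lbrakk>jordan_adjoint h k; x \<in> carrier V; y \<in> carrier V; z \<in> carrier V\<rbrakk> \<Longrightarrow>
   h (tprod V x y z) = tprod V (h x) y z \<ominus>\<^bsub>V\<^esub> tprod V x (k y) z \<oplus>\<^bsub>V\<^esub> tprod V x y (h z)"
  by (simp add: jordan_adjoint_def)

lemma jordan_adjoint_zero: "jordan_adjoint \<zero>\<^bsub>self_maps V\<^esub> \<zero>\<^bsub>self_maps V\<^esub>"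
  using linear_map_zero[OF is_module is_module linear_map_tprod_left]
    linear_map_zero[OF is_module is_module linear_map_tprod_right] tprod_zero_mid
  by (simp add: jordan_adjoint_def tprod_closed M.minus_eq M.r_neg)

lemma jordan_adjoint_add_box:
  assumes "jordan_adjoint h k" "h \<in> carrier (self_maps V)" "k \<in> carrier (self_maps V)"
    and [simp]: "a \<in> carrier V" "b \<in> carrier V"
  shows "jordan_adjoint (h \<oplus>\<^bsub>self_maps V\<^esub> box_op V a b) (k \<oplus>\<^bsub>self_maps V\<^esub> box_op V b a)"
  unfolding jordan_adjoint_def
proof (intro ballI)
  fix x y z assume [simp]: "x \<in> carrier V" "y \<in> carrier V" "z \<in> carrier V"
  have [simp]: "h u \<in> carrier V" "k u \<in> carrier V" if "u \<in> carrier V" for u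
    using assms(2,3) that by (simp_all add: self_maps_apply_closed)
  have "h (tprod V x y z) \<oplus>\<^bsub>V\<^esub> tprod V a b (tprod V x y z)
     = (tprod V (h x) y z \<oplus>\<^bsub>V\<^esub> tprod V (tprod V a b x) y z)
        \<ominus>\<^bsub>V\<^esub> (tprod V x (k y) z \<oplus>\<^bsub>V\<^esub> tprod V x (tprod V b a y) z)
        \<oplus>\<^bsub>V\<^esub> (tprod V x y (h z) \<oplus>\<^bsub>V\<^esub> tprod V x y (tprod V a b z))"
    using assms(1) jordan_identity[of a b x y z]
    by (simp add: jordan_adjoint_def tprod_closed add_minus_add_distrib)
  then show "(h \<oplus>\<^bsub>self_maps V\<^esub> box_op V a b) (tprod V x y z) =
      tprod V ((h \<oplus>\<^bsub>self_maps V\<^esub> box_op V a b) x) y z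
      \<ominus>\<^bsub>V\<^esub> tprod V x ((k \<oplus>\<^bsub>self_maps V\<^esub> box_op V b a) y) z
      \<oplus>\<^bsub>V\<^esub> tprod V x y ((h \<oplus>\<^bsub>self_maps V\<^esub> box_op V a b) z)"
    using linear_map_add[OF linear_map_tprod_right[of x y]]
    by (simp add: tprod_closed tprod_add_left tprod_add_mid)
qed

lemma jordan_adjoint_finsum_box:
  fixes n :: nat
  assumes "a \<in> {..<n} \<rightarrow> carrier V" "b \<in> {..<n} \<rightarrow> carrier V"
  shows "(\<Oplus>\<^bsub>self_maps V\<^esub>j\<in>{..<n}. box_op V (a j) (b j)) \<in> box_span V \<and>
    (\<Oplus>\<^bsub>self_maps V\<^esub>j\<in>{..<n}. box_op V (b j) (a j)) \<in> box_span V \<and>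
    jordan_adjoint (\<Oplus>\<^bsub>self_maps V\<^esub>j\<in>{..<n}. box_op V (a j) (b j))
      (\<Oplus>\<^bsub>self_maps V\<^esub>j\<in>{..<n}. box_op V (b j) (a j))"
  using assms
proof (induction n)
  case 0
  then show ?case by (simp add: box_span_zero jordan_adjoint_zero)
next
  case (Suc n)
  have ab: "a j \<in> carrier V" "b j \<in> carrier V" if "j < Suc n" for j using Suc.prems that by auto
  then have *: "a \<in> {..<n} \<rightarrow> carrier V" "b \<in> {..<n} \<rightarrow> carrier V" by auto
  show ?case
    using Suc.IH[OF *] ab
    by (simp add: finsum_lessThan_Suc[OF End.module_axioms] box_op_closed box_span_add_box
          jordan_adjoint_add_box box_span_closed)
qed

text \<open>The relation under the definite description in the definition of \<open>sharp\<close>.\<close>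

definition box_presentation :: "('a \<Rightarrow> 'a) \<Rightarrow> ('a \<Rightarrow> 'a) \<Rightarrow> bool" where
  "box_presentation h k \<longleftrightarrow> (\<exists>(n::nat) a b.
     a \<in> {..<n} \<rightarrow> carrier V \<and> b \<in> {..<n} \<rightarrow> carrier V \<and>
     h = (\<Oplus>\<^bsub>self_maps V\<^esub>j\<in>{..<n}. box_op V (a j) (b j)) \<and>
     k = (\<Oplus>\<^bsub>self_maps V\<^esub>j\<in>{..<n}. box_op V (b j) (a j)))"

lemma box_presentation_exists: "h \<in> box_span V \<Longrightarrow> \<exists>k. box_presentation h k"
proof (induction rule: box_span_induct)
  case zero
  show ?case unfolding box_presentation_def by (intro exI[of _ "\<zero>\<^bsub>self_maps V\<^esub>"] exI[of _ 0]) simp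
next
  case (add_box h u v)
  then obtain n :: nat and a b where ab: "a \<in> {..<n} \<rightarrow> carrier V" "b \<in> {..<n} \<rightarrow> carrier V"
    and h: "h = (\<Oplus>\<^bsub>self_maps V\<^esub>j\<in>{..<n}. box_op V (a j) (b j))"
    unfolding box_presentation_def by blast
  let ?a = "a(n := u)" and ?b = "b(n := v)"
  have "?a \<in> {..<Suc n} \<rightarrow> carrier V" "?b \<in> {..<Suc n} \<rightarrow> carrier V"
    using ab add_box by (auto simp: less_Suc_eq)
  moreover have "h \<oplus>\<^bsub>self_maps V\<^esub> box_op V u v
      = (\<Oplus>\<^bsub>self_maps V\<^esub>j\<in>{..<Suc n}. box_op V (?a j) (?b j))"
    unfolding h
    by (rule finsum_lessThan_snoc[OF End.module_axioms, symmetric])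
       (use ab add_box in \<open>auto intro!: box_op_closed\<close>)
  ultimately show ?case unfolding box_presentation_def by blast
qed

end

section \<open>Adjoints of sums of box operators\<close>

context jb_triple
begin

text \<open>The norm axiom equates the operator norm of \<open>z \<box> z\<close> with the square of the norm of \<open>z\<close>, so a
  vanishing \<open>z \<box> z\<close> forces \<open>z\<close> to have norm zero.\<close>

lemma box_self_eq_zero:
  assumes z: "z \<in> carrier V" and 0: "\<And>x. x \<in> carrier V \<Longrightarrow> tprod V z z x = \<zero>\<^bsub>V\<^esub>"
  shows "z = \<zero>\<^bsub>V\<^esub>"
proof -
  have "vnorm V \<zero>\<^bsub>V\<^esub> = 0" by (simp add: vnorm_zero_iff)
  then have "operator_norm V (box_op V z z) = (SUP x\<in>{x\<in>carrier V. vnorm V x \<le> 1}. 0)"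
    unfolding operator_norm_def by (intro SUP_cong) (auto simp: 0)
  moreover have "{x\<in>carrier V. vnorm V x \<le> 1} \<noteq> {}"
    using \<open>vnorm V \<zero>\<^bsub>V\<^esub> = 0\<close> by (force intro: M.zero_closed)
  ultimately have "(vnorm V z)\<^sup>2 = 0" using box_norm[OF z] by simp
  then show ?thesis using vnorm_zero_iff[OF z] by simp
qed

text \<open>If \<open>k\<close> and \<open>k'\<close> are both adjoint to \<open>h\<close>, then \<open>{x, k y - k' y, z} = 0\<close> for all \<open>x\<close>
  and \<open>z\<close>. Taking \<open>x = k y - k' y =: w\<close> gives \<open>w \<box> w = 0\<close>, hence \<open>w = 0\<close>.\<close>

lemma jordan_adjoint_unique:
  assumes "jordan_adjoint h k" "jordan_adjoint h k'" "h \<in> carrier (self_maps V)"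
    and k: "k \<in> carrier (self_maps V)" "k' \<in> carrier (self_maps V)"
  shows "k = k'"
proof (rule self_maps_eqI[OF k])
  fix y assume y: "y \<in> carrier V"
  have [simp]: "h u \<in> carrier V" "k u \<in> carrier V" "k' u \<in> carrier V" if "u \<in> carrier V" for u
    using assms(3) k that by (simp_all add: self_maps_apply_closed)
  have "tprod V x (k y) z = tprod V x (k' y) z" if [simp]: "x \<in> carrier V" "z \<in> carrier V" for x z
  proof -
    have "tprod V (h x) y z \<ominus>\<^bsub>V\<^esub> tprod V x (k y) z \<oplus>\<^bsub>V\<^esub> tprod V x y (h z)
      = tprod V (h x) y z \<ominus>\<^bsub>V\<^esub> tprod V x (k' y) z \<oplus>\<^bsub>V\<^esub> tprod V x y (h z)"
      using assms(1,2) y unfolding jordan_adjoint_def by (metis that)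
    then have "\<ominus>\<^bsub>V\<^esub> tprod V x (k y) z = \<ominus>\<^bsub>V\<^esub> tprod V x (k' y) z"
      using y by (simp add: M.minus_eq tprod_closed)
    then show ?thesis using y by (simp add: inj_on_eq_iff[OF M.a_inv_inj] tprod_closed)
  qed
  then have 0: "tprod V (k y \<ominus>\<^bsub>V\<^esub> k' y) (k y \<ominus>\<^bsub>V\<^esub> k' y) x = \<zero>\<^bsub>V\<^esub>" if "x \<in> carrier V" for x
    using y that tprod_minus_mid[of "k y \<ominus>\<^bsub>V\<^esub> k' y" "k y" "k' y" x]
    by (simp add: tprod_closed M.minus_eq M.r_neg)
  have "k y \<ominus>\<^bsub>V\<^esub> k' y = \<zero>\<^bsub>V\<^esub>" by (rule box_self_eq_zero[OF _ 0]) (simp_all add: y)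
  then show "k y = k' y"
    using y M.minus_equality[of "k y" "\<ominus>\<^bsub>V\<^esub> k' y"] by (simp add: M.minus_eq)
qed

text \<open>Well-definedness of \<open>sharp\<close>: all presentations of \<open>h\<close> yield a Jordan adjoint of \<open>h\<close>, and
  there is only one.\<close>

lemma sharp_spec:
  assumes h: "h \<in> box_span V"
  shows sharp_mem_box_span: "sharp V h \<in> box_span V"
    and jordan_adjoint_sharp: "jordan_adjoint h (sharp V h)"
proof -
  have adj: "k \<in> box_span V \<and> jordan_adjoint h k" if "box_presentation h k" for k
    using that jordan_adjoint_finsum_box unfolding box_presentation_def by blast
  obtain k where k: "box_presentation h k" using box_presentation_exists[OF h] by blast
  have "sharp V h = (THE k. box_presentation h k)"
    by (simp add: sharp_def box_presentation_def)
  also have "\<dots> = k"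
  proof (rule the_equality)
    fix k' assume "box_presentation h k'"
    note k' = adj[OF this]
    show "k' = k"
      by (rule jordan_adjoint_unique[of h]) (use k' adj[OF k] h in \<open>simp_all add: box_span_closed\<close>)
  qed (fact k)
  finally show "sharp V h \<in> box_span V" "jordan_adjoint h (sharp V h)"
    using adj[OF k] by simp_all
qed

lemma sharp_eqI:
  assumes "h \<in> box_span V" "jordan_adjoint h k" "k \<in> carrier (self_maps V)"
  shows "sharp V h = k"
  by (rule jordan_adjoint_unique[OF jordan_adjoint_sharp[OF assms(1)] assms(2)
        box_span_closed[OF assms(1)] box_span_closed[OF sharp_mem_box_span[OF assms(1)]] assms(3)])

lemma sharp_zero: "sharp V \<zero>\<^bsub>self_maps V\<^esub> = \<zero>\<^bsub>self_maps V\<^esub>"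
  by (intro sharp_eqI box_span_zero jordan_adjoint_zero End.M.zero_closed)

text \<open>The Jordan identity in operator form; it shows that the span of the box
  operators is closed under commutators.\<close>

lemma commutator_box:
  assumes h: "h \<in> box_span V" and [simp]: "a \<in> carrier V" "b \<in> carrier V"
  shows "commutator h (box_op V a b)
    = box_op V (h a) b \<ominus>\<^bsub>self_maps V\<^esub> box_op V a (sharp V h b)"
proof (rule self_maps_eqI[where M = V])
  have k: "sharp V h \<in> box_span V" "jordan_adjoint h (sharp V h)" 
    by (fact sharp_mem_box_span[OF h] jordan_adjoint_sharp[OF h])+
  note hc = box_span_closed[OF h]
  note [simp] = box_span_apply_closed[OF h] box_span_apply_closed[OF k(1)]
  show "commutator h (box_op V a b) \<in> carrier (self_maps V)"
    by (intro commutator_closed hc box_op_closed) simp_all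
  show "box_op V (h a) b \<ominus>\<^bsub>self_maps V\<^esub> box_op V a (sharp V h b) \<in> carrier (self_maps V)"
    by (intro End.M.minus_closed box_op_closed) simp_all
  fix z assume z [simp]: "z \<in> carrier V"
  have "h (tprod V a b z) \<ominus>\<^bsub>V\<^esub> tprod V a b (h z)
      = tprod V (h a) b z \<ominus>\<^bsub>V\<^esub> tprod V a (sharp V h b) z"
  proof -
    have "h (tprod V a b z)
      = tprod V (h a) b z \<ominus>\<^bsub>V\<^esub> tprod V a (sharp V h b) z \<oplus>\<^bsub>V\<^esub> tprod V a b (h z)"
      using k(2) by (rule jordan_adjointD) simp_all
    then show ?thesis
      by (simp add: tprod_closed M.minus_eq M.a_assoc M.r_neg)
  qed
  then show "commutator h (box_op V a b) z
      = (box_op V (h a) b \<ominus>\<^bsub>self_maps V\<^esub> box_op V a (sharp V h b)) z"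
    by (simp add: commutator_apply hc box_op_closed self_maps_minus_apply[OF is_module])
qed

lemma commutator_mem_box_span:
  assumes h: "h \<in> box_span V" and k: "k \<in> box_span V"
  shows "commutator h k \<in> box_span V"
  using k
proof (induction rule: box_span_induct)
  case zero
  have "commutator h \<zero>\<^bsub>self_maps V\<^esub> = \<zero>\<^bsub>self_maps V\<^esub>"
    by (rule self_maps_eqI[where M = V])
       (simp_all add: commutator_closed commutator_apply box_span_apply_closed h box_span_closed
         linear_map_zero[OF is_module is_module linear_map_box_span] M.minus_eq M.r_neg)
  then show ?case by (simp add: box_span_zero)
next
  case (add_box k a b)
  note [simp] = box_span_apply_closed[OF h] box_span_apply_closed[OF add_box.hyps(1)]
    add_box.hyps(3,4)
  have cl: "h \<in> carrier (self_maps V)" "k \<in> carrier (self_maps V)"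
    "box_op V a b \<in> carrier (self_maps V)"
    using h add_box by (simp_all add: box_span_closed box_op_closed)
  have "commutator h (k \<oplus>\<^bsub>self_maps V\<^esub> box_op V a b)
     = commutator h k \<oplus>\<^bsub>self_maps V\<^esub> commutator h (box_op V a b)"
  proof (rule self_maps_eqI[where M = V])
    fix x assume [simp]: "x \<in> carrier V"
    have "h (k x \<oplus>\<^bsub>V\<^esub> tprod V a b x) \<ominus>\<^bsub>V\<^esub> (k (h x) \<oplus>\<^bsub>V\<^esub> tprod V a b (h x))
        = (h (k x) \<ominus>\<^bsub>V\<^esub> k (h x)) \<oplus>\<^bsub>V\<^esub> (h (tprod V a b x) \<ominus>\<^bsub>V\<^esub> tprod V a b (h x))"
      by (simp add: linear_map_add[OF linear_map_box_span[OF h]] tprod_closed M.minus_eq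
          M.minus_add M.a_ac)
    then show "commutator h (k \<oplus>\<^bsub>self_maps V\<^esub> box_op V a b) x
        = (commutator h k \<oplus>\<^bsub>self_maps V\<^esub> commutator h (box_op V a b)) x"
      by (simp add: commutator_apply cl)
  qed (intro commutator_closed End.M.a_closed cl)+
  moreover have "commutator h (box_op V a b) \<in> box_span V"
    unfolding commutator_box[OF h add_box.hyps(3,4)]
    by (intro box_span_minus box_op_mem_box_span)
       (simp_all add: box_span_apply_closed[OF sharp_mem_box_span[OF h]])
  ultimately show ?case
    using add_box.IH by (simp add: box_span_add)
qed

end

section \<open>The categories of JB*-triples and of TKK Lie algebras\<close>

lemma TKK_simps [simp]:
  "carrier (TKK V) = carrier V \<times> box_span V \<times> carrier V"
  "(x, h, y) \<oplus>\<^bsub>TKK V\<^esub> (u, k, v) = (x \<oplus>\<^bsub>V\<^esub> u, h \<oplus>\<^bsub>self_maps V\<^esub> k, y \<oplus>\<^bsub>V\<^esub> v)"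
  "c \<odot>\<^bsub>TKK V\<^esub> (x, h, y) = (c \<odot>\<^bsub>V\<^esub> x, c \<odot>\<^bsub>self_maps V\<^esub> h, cnj c \<odot>\<^bsub>V\<^esub> y)"
  "bracket (TKK V) (x, h, y) (u, k, v) =
     (h u \<ominus>\<^bsub>V\<^esub> k x,
      (compose (carrier V) h k \<ominus>\<^bsub>self_maps V\<^esub> compose (carrier V) k h)
        \<oplus>\<^bsub>self_maps V\<^esub> box_op V x v \<ominus>\<^bsub>self_maps V\<^esub> box_op V u y,
      sharp V k y \<ominus>\<^bsub>V\<^esub> sharp V h v)"
  "invol (TKK V) (x, h, y) = (y, \<ominus>\<^bsub>self_maps V\<^esub> sharp V h, x)"
  "component (TKK V) (- 1) = carrier V \<times> {\<zero>\<^bsub>self_maps V\<^esub>} \<times> {\<zero>\<^bsub>V\<^esub>}"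
  "component (TKK V) 0 = {\<zero>\<^bsub>V\<^esub>} \<times> box_span V \<times> {\<zero>\<^bsub>V\<^esub>}"
  "component (TKK V) 1 = {\<zero>\<^bsub>V\<^esub>} \<times> {\<zero>\<^bsub>self_maps V\<^esub>} \<times> carrier V"
  by (simp_all add: TKK_def)

lemma TKK_carrierE:
  assumes "p \<in> carrier (TKK V)"
  obtains x h y where "p = (x, h, y)" "x \<in> carrier V" "h \<in> box_span V" "y \<in> carrier V"
  using assms by (cases p) auto

context jb_triple
begin

lemma TKK_closed:
  assumes "p \<in> carrier (TKK V)" "q \<in> carrier (TKK V)"
  shows "p \<oplus>\<^bsub>TKK V\<^esub> q \<in> carrier (TKK V)" "c \<odot>\<^bsub>TKK V\<^esub> p \<in> carrier (TKK V)"
    and "bracket (TKK V) p q \<in> carrier (TKK V)" "invol (TKK V) p \<in> carrier (TKK V)"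
proof -
  obtain x h y u k v where pq: "p = (x, h, y)" "q = (u, k, v)" by (metis prod_cases3)
  have *: "x \<in> carrier V" "h \<in> box_span V" "y \<in> carrier V"
    "u \<in> carrier V" "k \<in> box_span V" "v \<in> carrier V"
    using assms by (auto simp: pq)
  note mem = box_span_apply_closed sharp_mem_box_span box_op_mem_box_span box_span_minus
    box_span_add box_span_smult commutator_mem_box_span
  show "p \<oplus>\<^bsub>TKK V\<^esub> q \<in> carrier (TKK V)" "c \<odot>\<^bsub>TKK V\<^esub> p \<in> carrier (TKK V)"
    using * by (simp_all add: pq mem)
  show "bracket (TKK V) p q \<in> carrier (TKK V)" "invol (TKK V) p \<in> carrier (TKK V)"
    using * by (simp_all add: pq mem)
qed

lemma component_TKK_subset: "j \<in> {- 1, 0, 1} \<Longrightarrow> component (TKK V) j \<subseteq> carrier (TKK V)"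
  using box_span_zero by auto

end

text \<open>For categories of structured sets, the category laws reduce to closure under identities and
  composition.\<close>

lemma is_category_extensional_maps:
  fixes C :: "('o, 'b \<Rightarrow> 'b) category" and car :: "'o \<Rightarrow> 'b set"
  assumes Ide: "\<And>X. Ide C X = (\<lambda>x\<in>car X. x)"
    and Comp: "\<And>X Y Z g f. Comp C X Y Z g f = compose (car X) g f"
    and Hom: "\<And>X Y f. f \<in> Hom C X Y \<Longrightarrow> f \<in> car X \<rightarrow> car Y \<and> f \<in> extensional (car X)"
    and Ide_mem: "\<And>X. X \<in> Obj C \<Longrightarrow> (\<lambda>x\<in>car X. x) \<in> Hom C X X"
    and Comp_mem: "\<And>X Y Z f g. \<lbrakk>X \<in> Obj C; f \<in> Hom C X Y; g \<in> Hom C Y Z\<rbrakk>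
      \<Longrightarrow> compose (car X) g f \<in> Hom C X Z"
  shows "is_category C"
  unfolding is_category_def Ide Comp
proof (intro conjI ballI)
  fix X Y f assume "f \<in> Hom C X Y"
  note f = Hom[OF this]
  show "compose (car X) f (\<lambda>x\<in>car X. x) = f" by (rule compose_Id[of _ _ "car Y"]) (use f in auto)
  show "compose (car X) (\<lambda>x\<in>car Y. x) f = f" by (rule Id_compose) (use f in auto)
next
  fix W X Y Z f g h assume "f \<in> Hom C W X"
  then show "compose (car W) h (compose (car W) g f) = compose (car W) (compose (car X) h g) f"
    by (rule compose_assoc[OF Hom[THEN conjunct1]])
qed (simp_all add: Ide_mem Comp_mem)

lemma is_category_JB: "is_category JB_category"
proof (rule is_category_extensional_maps[where car = carrier])
  show "Ide JB_category V = (\<lambda>x\<in>carrier V. x)"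
    and "Comp JB_category U V W g f = compose (carrier U) g f"
    for U V W :: "'a normed_triple" and f g
    by (simp_all add: JB_category_def)
  show "f \<in> carrier V \<rightarrow> carrier W \<and> f \<in> extensional (carrier V)"
    if "f \<in> Hom JB_category V W" for V W :: "'a normed_triple" and f
    using that by (auto simp: JB_category_def triple_isos_def linear_map_def)
next
  fix U :: "'a normed_triple" assume "U \<in> Obj JB_category"
  then interpret jb_triple U by (simp add: JB_category_def)
  show "(\<lambda>x\<in>carrier U. x) \<in> Hom JB_category U U"
    by (auto simp: JB_category_def triple_isos_def linear_map_def bij_betw_def tprod_closed)
  fix V W :: "'a normed_triple" and f g
  assume "f \<in> Hom JB_category U V" "g \<in> Hom JB_category V W"
  then show "compose (carrier U) g f \<in> Hom JB_category U W"
    using bij_betw_compose[of f "carrier U" "carrier V" g "carrier W"]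
    by (auto simp: JB_category_def triple_isos_def linear_map_def compose_eq tprod_closed Pi_iff)
qed

lemma is_category_TKK: "is_category TKK_category"
proof (rule is_category_extensional_maps[where car = carrier])
  show "Ide TKK_category A = (\<lambda>p\<in>carrier A. p)"
    and "Comp TKK_category A B D g f = compose (carrier A) g f"
    for A B D :: "('a \<times> ('a \<Rightarrow> 'a) \<times> 'a) graded_lie" and f g
    by (simp_all add: TKK_category_def)
  show "f \<in> carrier A \<rightarrow> carrier B \<and> f \<in> extensional (carrier A)"
    if "f \<in> Hom TKK_category A B" for A B :: "('a \<times> ('a \<Rightarrow> 'a) \<times> 'a) graded_lie" and f
    using that by (auto simp: TKK_category_def graded_invol_isos_def linear_map_def)
next
  fix A :: "('a \<times> ('a \<Rightarrow> 'a) \<times> 'a) graded_lie" assume "A \<in> Obj TKK_category"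
  then obtain V where A: "A = TKK V" and "jb_triple V" by (auto simp: TKK_category_def)
  then interpret jb_triple V by simp
  note closed = TKK_closed[folded A] and component_subset = component_TKK_subset[folded A]
  have Hom: "Hom TKK_category = graded_invol_isos" by (simp add: TKK_category_def)
  show "(\<lambda>p\<in>carrier A. p) \<in> Hom TKK_category A A"
    unfolding Hom graded_invol_isos_def linear_map_def bij_betw_def
    using component_subset by (auto simp: closed)
  fix B D :: "('a \<times> ('a \<Rightarrow> 'a) \<times> 'a) graded_lie" and f g
  assume f: "f \<in> Hom TKK_category A B" and g: "g \<in> Hom TKK_category B D"
  have "compose (carrier A) g f ` component A j \<subseteq> component D j" if j: "j \<in> {- 1, 0, 1}" for j
  proof -
    have "f ` component A j \<subseteq> component B j" "g ` component B j \<subseteq> component D j"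
      using f g j unfolding Hom graded_invol_isos_def by blast+
    moreover have "component A j \<subseteq> carrier A" using component_subset j by blast
    ultimately show ?thesis by (force simp: compose_eq)
  qed
  moreover have f': "bij_betw f (carrier A) (carrier B)" "linear_map A B f"
      "\<And>p q. p \<in> carrier A \<Longrightarrow> q \<in> carrier A \<Longrightarrow> f (bracket A p q) = bracket B (f p) (f q)"
      "\<And>p. p \<in> carrier A \<Longrightarrow> f (invol A p) = invol B (f p)"
    and g': "bij_betw g (carrier B) (carrier D)" "linear_map B D g"
      "\<And>p q. p \<in> carrier B \<Longrightarrow> q \<in> carrier B \<Longrightarrow> g (bracket B p q) = bracket D (g p) (g q)"
      "\<And>p. p \<in> carrier B \<Longrightarrow> g (invol B p) = invol D (g p)"
    using f g by (simp_all add: Hom graded_invol_isos_def)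
  moreover have "bij_betw (compose (carrier A) g f) (carrier A) (carrier D)"
    by (rule bij_betw_compose[OF f'(1) g'(1)])
  moreover have "linear_map A D (compose (carrier A) g f)"
    unfolding linear_map_def
    by (auto simp: compose_eq closed linear_mapD[OF f'(2)] linear_mapD[OF g'(2)])
  ultimately show "compose (carrier A) g f \<in> Hom TKK_category A D"
    by (simp add: Hom graded_invol_isos_def compose_eq closed linear_map_closed)
qed

section \<open>The functor on morphisms\<close>

definition conjugate_by :: "'a normed_triple \<Rightarrow> 'a normed_triple \<Rightarrow> ('a \<Rightarrow> 'a) \<Rightarrow> ('a \<Rightarrow> 'a) \<Rightarrow> 'a \<Rightarrow> 'a"
  where "conjugate_by V W \<phi> h = (\<lambda>w\<in>carrier W. \<phi> (h (inv_into (carrier V) \<phi> w)))"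

lemma TKK_map_apply:
  "(x, h, y) \<in> carrier (TKK V) \<Longrightarrow> TKK_map V W \<phi> (x, h, y) = (\<phi> x, conjugate_by V W \<phi> h, \<phi> y)"
  by (simp add: TKK_map_def conjugate_by_def)

locale jb_triple_iso = V: jb_triple V + W: jb_triple W
  for V W :: "'a normed_triple" +
  fixes \<phi> :: "'a \<Rightarrow> 'a"
  assumes triple_iso: "\<phi> \<in> triple_isos V W"
begin

lemma bij: "bij_betw \<phi> (carrier V) (carrier W)"
  and linear: "linear_map V W \<phi>"
  and extensional: "\<phi> \<in> extensional (carrier V)"
  and tprod: "\<lbrakk>x \<in> carrier V; y \<in> carrier V; z \<in> carrier V\<rbrakk>
    \<Longrightarrow> \<phi> (tprod V x y z) = tprod W (\<phi> x) (\<phi> y) (\<phi> z)"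
  using triple_iso by (simp_all add: triple_isos_def)

lemmas apply_closed [simp] = linear_map_closed[OF linear]
  and apply_add = linear_map_add[OF linear]
  and apply_smult = linear_map_smult[OF linear]
  and apply_minus = linear_map_minus[OF V.is_module W.is_module linear]
  and apply_zero [simp] = linear_map_zero[OF V.is_module W.is_module linear]

lemma surjE: "w \<in> carrier W \<Longrightarrow> (\<And>x. x \<in> carrier V \<Longrightarrow> w = \<phi> x \<Longrightarrow> P) \<Longrightarrow> P"
  using bij unfolding bij_betw_def by blast

lemma eq_iff: "\<lbrakk>x \<in> carrier V; y \<in> carrier V\<rbrakk> \<Longrightarrow> \<phi> x = \<phi> y \<longleftrightarrow> x = y"
  using bij by (meson bij_betw_imp_inj_on inj_on_eq_iff)

abbreviation conjugate where "conjugate \<equiv> conjugate_by V W \<phi>"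

lemma conjugate_closed: "h \<in> carrier (self_maps V) \<Longrightarrow> conjugate h \<in> carrier (self_maps W)"
  using bij by (auto simp: carrier_self_maps conjugate_by_def bij_betw_def inv_into_into PiE_iff)

lemma conjugate_apply: "x \<in> carrier V \<Longrightarrow> conjugate h (\<phi> x) = \<phi> (h x)"
  using bij by (simp add: conjugate_by_def bij_betw_def)

text \<open>As every element of \<open>W\<close> is of the form \<open>\<phi> x\<close>, the intertwining relation characterises the
  conjugate; the inverse of \<open>\<phi>\<close> never has to be mentioned again.\<close>

lemma conjugate_eqI:
  assumes "h \<in> carrier (self_maps V)" "k \<in> carrier (self_maps W)"
    and "\<And>x. x \<in> carrier V \<Longrightarrow> k (\<phi> x) = \<phi> (h x)"
  shows "conjugate h = k"
proof (rule self_maps_eqI[OF conjugate_closed[OF assms(1)] assms(2)])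
  fix w assume "w \<in> carrier W"
  then show "conjugate h w = k w" by (rule surjE) (simp add: conjugate_apply assms(3))
qed

lemma conjugate_inject:
  assumes "h \<in> carrier (self_maps V)" "h' \<in> carrier (self_maps V)" "conjugate h = conjugate h'"
  shows "h = h'"
proof (rule self_maps_eqI[OF assms(1,2)])
  fix x assume x: "x \<in> carrier V"
  then have "\<phi> (h x) = \<phi> (h' x)" using conjugate_apply[OF x] assms(3) by metis
  then show "h x = h' x" using x assms(1,2) by (simp add: eq_iff self_maps_apply_closed)
qed

lemma conjugate_zero: "conjugate \<zero>\<^bsub>self_maps V\<^esub> = \<zero>\<^bsub>self_maps W\<^esub>"
  by (rule conjugate_eqI) simp_all

lemma conjugate_add:
  "\<lbrakk>h \<in> carrier (self_maps V); k \<in> carrier (self_maps V)\<rbrakk>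
   \<Longrightarrow> conjugate (h \<oplus>\<^bsub>self_maps V\<^esub> k) = conjugate h \<oplus>\<^bsub>self_maps W\<^esub> conjugate k"
  by (rule conjugate_eqI) (simp_all add: conjugate_closed conjugate_apply apply_add self_maps_apply_closed)

lemma conjugate_smult:
  "h \<in> carrier (self_maps V) \<Longrightarrow> conjugate (c \<odot>\<^bsub>self_maps V\<^esub> h) = c \<odot>\<^bsub>self_maps W\<^esub> conjugate h"
  by (rule conjugate_eqI)
     (simp_all add: V.End_smult_closed W.End_smult_closed conjugate_closed conjugate_apply apply_smult
       self_maps_apply_closed)

lemma conjugate_minus:
  "\<lbrakk>h \<in> carrier (self_maps V); k \<in> carrier (self_maps V)\<rbrakk>
   \<Longrightarrow> conjugate (h \<ominus>\<^bsub>self_maps V\<^esub> k) = conjugate h \<ominus>\<^bsub>self_maps W\<^esub> conjugate k"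
  by (rule conjugate_eqI)
     (simp_all add: conjugate_closed conjugate_apply apply_minus self_maps_apply_closed
       self_maps_minus_apply[OF V.is_module] self_maps_minus_apply[OF W.is_module])

lemma conjugate_compose:
  "\<lbrakk>h \<in> carrier (self_maps V); k \<in> carrier (self_maps V)\<rbrakk>
   \<Longrightarrow> conjugate (compose (carrier V) h k) = compose (carrier W) (conjugate h) (conjugate k)"
  by (rule conjugate_eqI)
     (simp_all add: conjugate_closed compose_closed compose_eq conjugate_apply self_maps_apply_closed)

lemma conjugate_box:
  "\<lbrakk>a \<in> carrier V; b \<in> carrier V\<rbrakk> \<Longrightarrow> conjugate (box_op V a b) = box_op W (\<phi> a) (\<phi> b)"
  by (rule conjugate_eqI) (simp_all add: V.box_op_closed W.box_op_closed tprod)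

lemma conjugate_mem_box_span: "h \<in> box_span V \<Longrightarrow> conjugate h \<in> box_span W"
proof (induction rule: V.box_span_induct)
  case (add_box h a b)
  then show ?case by (simp add: conjugate_add conjugate_box V.box_op_closed W.box_span_add_box)
qed (simp add: conjugate_zero W.box_span_zero)

lemma conjugate_surj: "k \<in> box_span W \<Longrightarrow> \<exists>h\<in>box_span V. k = conjugate h"
proof (induction rule: W.box_span_induct)
  case zero
  show ?case using conjugate_zero V.box_span_zero by metis
next
  case (add_box k a b)
  then obtain h where h: "h \<in> box_span V" "k = conjugate h" by blast
  obtain x y where xy: "x \<in> carrier V" "y \<in> carrier V" "a = \<phi> x" "b = \<phi> y"
    using add_box.hyps surjE by metis
  have "k \<oplus>\<^bsub>self_maps W\<^esub> box_op W a b = conjugate (h \<oplus>\<^bsub>self_maps V\<^esub> box_op V x y)"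
    using h xy by (simp add: conjugate_add conjugate_box V.box_op_closed V.box_span_closed)
  then show ?case using V.box_span_add_box h xy by blast
qed

text \<open>Being a Jordan adjoint is expressed by the triple product alone, so it is carried over by triple
  isomorphisms; uniqueness does the rest.\<close>

lemma sharp_conjugate:
  assumes h: "h \<in> box_span V"
  shows "sharp W (conjugate h) = conjugate (sharp V h)"
proof (rule W.sharp_eqI)
  let ?k = "sharp V h"
  have k: "?k \<in> box_span V" by (rule V.sharp_mem_box_span[OF h])
  show "conjugate h \<in> box_span W" by (rule conjugate_mem_box_span[OF h])
  show "conjugate ?k \<in> carrier (self_maps W)" by (intro conjugate_closed V.box_span_closed k)
  show "W.jordan_adjoint (conjugate h) (conjugate ?k)"
    unfolding W.jordan_adjoint_def
  proof (intro ballI)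
    fix x y z assume "x \<in> carrier W" "y \<in> carrier W" "z \<in> carrier W"
    then obtain u v w where [simp]: "u \<in> carrier V" "v \<in> carrier V" "w \<in> carrier V"
      and xyz: "x = \<phi> u" "y = \<phi> v" "z = \<phi> w"
      using surjE by metis
    note [simp] = V.box_span_apply_closed[OF h] V.box_span_apply_closed[OF k] V.tprod_closed
    have "conjugate h (tprod W x y z) = \<phi> (h (tprod V u v w))"
      by (simp add: xyz conjugate_apply flip: tprod)
    also have "\<dots> = \<phi> (tprod V (h u) v w \<ominus>\<^bsub>V\<^esub> tprod V u (?k v) w \<oplus>\<^bsub>V\<^esub> tprod V u v (h w))"
      by (simp add: V.jordan_adjointD[OF V.jordan_adjoint_sharp[OF h]])
    finally show "conjugate h (tprod W x y z) =
       tprod W (conjugate h x) y z \<ominus>\<^bsub>W\<^esub> tprod W x (conjugate ?k y) z \<oplus>\<^bsub>W\<^esub> tprod W x y (conjugate h z)"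
      by (simp add: xyz apply_add apply_minus tprod conjugate_apply)
  qed
qed

lemma conjugate_uminus:
  "h \<in> carrier (self_maps V) \<Longrightarrow> conjugate (\<ominus>\<^bsub>self_maps V\<^esub> h) = \<ominus>\<^bsub>self_maps W\<^esub> conjugate h"
  by (simp add: uminus_eq_smult[OF V.End.module_axioms] uminus_eq_smult[OF W.End.module_axioms]
      conjugate_closed conjugate_smult)

text \<open>Conjugation is compatible with every ingredient of the bracket and of the involution, by
  \<open>sharp_conjugate\<close> also with \<open>h \<mapsto> h\<^sup>\<natural>\<close>. Surjectivity in degree \<open>0\<close> holds since every box operator
  of \<open>W\<close> has the form \<open>\<phi> x \<box> \<phi> y\<close>.\<close>

lemma TKK_map_mem: "TKK_map V W \<phi> \<in> graded_invol_isos (TKK V) (TKK W)"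
proof -
  let ?T = "TKK_map V W \<phi>"
  note closed = V.box_span_closed V.box_span_apply_closed V.sharp_mem_box_span
    V.box_op_mem_box_span V.box_span_minus V.box_span_add V.box_span_smult
    V.commutator_mem_box_span V.box_span_zero compose_closed
  have T: "?T (x, h, y) = (\<phi> x, conjugate h, \<phi> y)"
    if "x \<in> carrier V" "h \<in> box_span V" "y \<in> carrier V" for x h y
    using that by (simp add: TKK_map_apply)
  have "bij_betw ?T (carrier (TKK V)) (carrier (TKK W))"
    unfolding bij_betw_def
  proof
    show "inj_on ?T (carrier (TKK V))"
      by (auto simp: inj_on_def T eq_iff intro: conjugate_inject V.box_span_closed)
    show "?T ` carrier (TKK V) = carrier (TKK W)"
    proof
      show "?T ` carrier (TKK V) \<subseteq> carrier (TKK W)"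
        by (auto simp: T conjugate_mem_box_span)
      show "carrier (TKK W) \<subseteq> ?T ` carrier (TKK V)"
      proof
        fix q assume "q \<in> carrier (TKK W)"
        then obtain u k v where q: "q = (u, k, v)" "u \<in> carrier W" "k \<in> box_span W" "v \<in> carrier W"
          by auto
        then obtain x h y where "x \<in> carrier V" "u = \<phi> x" "h \<in> box_span V" "k = conjugate h"
          "y \<in> carrier V" "v = \<phi> y"
          using surjE conjugate_surj by metis
        then show "q \<in> ?T ` carrier (TKK V)"
          by (intro image_eqI[of _ _ "(x, h, y)"]) (simp_all add: q T)
      qed
    qed
  qed
  moreover have "linear_map (TKK V) (TKK W) ?T"
    unfolding linear_map_def
    by (auto simp: T closed conjugate_mem_box_span conjugate_add conjugate_smult apply_add apply_smult)
  moreover have "?T (bracket (TKK V) p q) = bracket (TKK W) (?T p) (?T q)"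
    if p: "p \<in> carrier (TKK V)" and q: "q \<in> carrier (TKK V)" for p q
  proof -
    obtain x h y where p: "p = (x, h, y)" "x \<in> carrier V" "h \<in> box_span V" "y \<in> carrier V"
      using p by (rule TKK_carrierE)
    obtain u k v where q: "q = (u, k, v)" "u \<in> carrier V" "k \<in> box_span V" "v \<in> carrier V"
      using q by (rule TKK_carrierE)
    show ?thesis
      using p(2-4) q(2-4) unfolding p(1) q(1)
      by (simp add: T closed apply_minus conjugate_apply conjugate_minus conjugate_add conjugate_compose conjugate_box
          sharp_conjugate V.box_op_closed)
  qed
  moreover have "?T ` component (TKK V) j \<subseteq> component (TKK W) j" if "j \<in> {- 1, 0, 1}" for j
    using that by (auto simp: T closed conjugate_zero conjugate_mem_box_span)
  moreover have "?T (invol (TKK V) p) = invol (TKK W) (?T p)" if "p \<in> carrier (TKK V)" for p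
    using that by (auto simp: T closed sharp_conjugate conjugate_uminus)
  moreover have "?T \<in> extensional (carrier (TKK V))"
    by (simp add: TKK_map_def)
  ultimately show ?thesis
    unfolding graded_invol_isos_def by blast
qed

end

section \<open>Fullness\<close>

context jb_triple
begin

lemma neg_zero: "\<ominus>\<^bsub>V\<^esub> \<zero>\<^bsub>V\<^esub> = \<zero>\<^bsub>V\<^esub>" "\<ominus>\<^bsub>self_maps V\<^esub> \<zero>\<^bsub>self_maps V\<^esub> = \<zero>\<^bsub>self_maps V\<^esub>"
  by (rule M.minus_equality End.M.minus_equality; simp)+

lemma minus_zero_right:
  "x \<in> carrier V \<Longrightarrow> x \<ominus>\<^bsub>V\<^esub> \<zero>\<^bsub>V\<^esub> = x"
  "h \<in> carrier (self_maps V) \<Longrightarrow> h \<ominus>\<^bsub>self_maps V\<^esub> \<zero>\<^bsub>self_maps V\<^esub> = h"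
  by (simp_all add: a_minus_def neg_zero)

lemma zero_apply: "h \<in> box_span V \<Longrightarrow> h \<zero>\<^bsub>V\<^esub> = \<zero>\<^bsub>V\<^esub>"
  by (rule linear_map_zero[OF is_module is_module linear_map_box_span])

lemma box_op_zero:
  "a \<in> carrier V \<Longrightarrow> box_op V a \<zero>\<^bsub>V\<^esub> = \<zero>\<^bsub>self_maps V\<^esub>"
  by (rule self_maps_eqI[where M = V]) (simp_all add: box_op_closed tprod_zero_mid)

lemma commutator_zero:
  assumes "h \<in> box_span V"
  shows "commutator h \<zero>\<^bsub>self_maps V\<^esub> = \<zero>\<^bsub>self_maps V\<^esub>"
    and "commutator \<zero>\<^bsub>self_maps V\<^esub> h = \<zero>\<^bsub>self_maps V\<^esub>"
  by (rule self_maps_eqI[where M = V];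
      simp add: assms commutator_closed box_span_closed commutator_apply zero_apply
        box_span_apply_closed M.minus_eq neg_zero)+

lemma bracket_TKK_degree_0_neg:
  "\<lbrakk>h \<in> box_span V; u \<in> carrier V\<rbrakk> \<Longrightarrow>
   bracket (TKK V) (\<zero>\<^bsub>V\<^esub>, h, \<zero>\<^bsub>V\<^esub>) (u, \<zero>\<^bsub>self_maps V\<^esub>, \<zero>\<^bsub>V\<^esub>) = (h u, \<zero>\<^bsub>self_maps V\<^esub>, \<zero>\<^bsub>V\<^esub>)"
  by (simp add: commutator_zero box_op_zero sharp_zero zero_apply sharp_mem_box_span
      box_span_apply_closed minus_zero_right)

lemma bracket_TKK_neg_pos:
  "\<lbrakk>x \<in> carrier V; v \<in> carrier V\<rbrakk> \<Longrightarrow>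
   bracket (TKK V) (x, \<zero>\<^bsub>self_maps V\<^esub>, \<zero>\<^bsub>V\<^esub>) (\<zero>\<^bsub>V\<^esub>, \<zero>\<^bsub>self_maps V\<^esub>, v) = (\<zero>\<^bsub>V\<^esub>, box_op V x v, \<zero>\<^bsub>V\<^esub>)"
  by (simp add: commutator_zero box_span_zero box_op_zero sharp_zero box_op_closed
      minus_zero_right)

end

text \<open>A graded isomorphism \<open>T\<close> acts on the degree \<open>-1\<close> part by some \<open>\<phi>\<close>. Commuting with the
  involution, which swaps the degrees \<open>-1\<close> and \<open>1\<close>, forces it to act by \<open>\<phi>\<close> in degree \<open>1\<close> as
  well. The brackets \<open>[h, u] = h u\<close> and \<open>[x, v] = x \<box> v\<close> (\<open>h\<close>, \<open>u\<close>, \<open>x\<close>, \<open>v\<close> of degrees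
  \<open>0, -1, -1, 1\<close>) show that \<open>T\<close> conjugates the degree \<open>0\<close> part by \<open>\<phi>\<close> and maps \<open>x \<box> v\<close> to
  \<open>\<phi> x \<box> \<phi> v\<close>; together these say that \<open>\<phi>\<close> preserves \<open>{x, v, u}\<close>.\<close>

lemma graded_invol_iso_is_TKK_map:
  assumes "jb_triple V" "jb_triple W" and T: "T \<in> graded_invol_isos (TKK V) (TKK W)"
  defines "\<phi> \<equiv> \<lambda>x\<in>carrier V. fst (T (x, \<zero>\<^bsub>self_maps V\<^esub>, \<zero>\<^bsub>V\<^esub>))"
  shows "\<phi> \<in> triple_isos V W" and "TKK_map V W \<phi> = T"
proof -
  interpret V: jb_triple V by fact
  interpret W: jb_triple W by fact
  let ?z = "\<zero>\<^bsub>V\<^esub>" and ?Z = "\<zero>\<^bsub>self_maps V\<^esub>" and ?z' = "\<zero>\<^bsub>W\<^esub>" and ?Z' = "\<zero>\<^bsub>self_maps W\<^esub>"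
  have bij: "bij_betw T (carrier (TKK V)) (carrier (TKK W))"
    and linear: "linear_map (TKK V) (TKK W) T"
    and bracket: "\<And>p q. p \<in> carrier (TKK V) \<Longrightarrow> q \<in> carrier (TKK V) \<Longrightarrow>
      T (bracket (TKK V) p q) = bracket (TKK W) (T p) (T q)"
    and comp: "\<And>j. j \<in> {- 1, 0, 1} \<Longrightarrow> T ` component (TKK V) j \<subseteq> component (TKK W) j"
    and invol: "\<And>p. p \<in> carrier (TKK V) \<Longrightarrow> T (invol (TKK V) p) = invol (TKK W) (T p)"
    and ext: "T \<in> extensional (carrier (TKK V))"
    using T unfolding graded_invol_isos_def by blast+
  note [simp] = V.box_span_zero W.box_span_zero V.sharp_zero W.sharp_zero V.neg_zero W.neg_zero
  \<comment> \<open>preserving degrees gives the shape of the values in degrees -1 and 0, the involution carries degree -1 to 1\<close>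
  have neg: "T (x, ?Z, ?z) = (\<phi> x, ?Z', ?z')" "\<phi> x \<in> carrier W" if "x \<in> carrier V" for x
  proof -
    have "T (x, ?Z, ?z) \<in> component (TKK W) (- 1)"
      using comp[of "-1"] that by auto
    then show "T (x, ?Z, ?z) = (\<phi> x, ?Z', ?z')" "\<phi> x \<in> carrier W"
      using that by (auto simp: \<phi>_def)
  qed
  have pos: "T (?z, ?Z, y) = (?z', ?Z', \<phi> y)" if "y \<in> carrier V" for y
    using invol[of "(y, ?Z, ?z)"] that by (simp add: neg)
  define c where "c h = fst (snd (T (?z, h, ?z)))" for h
  have mid: "T (?z, h, ?z) = (?z', c h, ?z')" "c h \<in> box_span W" if "h \<in> box_span V" for h
  proof -
    have "T (?z, h, ?z) \<in> component (TKK W) 0"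
      using comp[of 0] that by auto
    then show "T (?z, h, ?z) = (?z', c h, ?z')" "c h \<in> box_span W"
      by (auto simp: c_def)
  qed
  \<comment> \<open>apply T to [h, u] = h u\<close>
  have c_apply: "c h (\<phi> u) = \<phi> (h u)" if "h \<in> box_span V" "u \<in> carrier V" for h u
  proof -
    have "T (bracket (TKK V) (?z, h, ?z) (u, ?Z, ?z))
        = bracket (TKK W) (?z', c h, ?z') (\<phi> u, ?Z', ?z')"
      using that by (subst bracket) (simp_all add: mid neg)
    then show ?thesis
      using that
      by (simp add: V.bracket_TKK_degree_0_neg W.bracket_TKK_degree_0_neg mid neg
          V.box_span_apply_closed del: TKK_simps)
  qed
  \<comment> \<open>apply T to [x, v], which is the box operator of x and v\<close>
  have c_box: "c (box_op V x v) = box_op W (\<phi> x) (\<phi> v)"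
    if "x \<in> carrier V" "v \<in> carrier V" for x v
  proof -
    have "T (bracket (TKK V) (x, ?Z, ?z) (?z, ?Z, v))
        = bracket (TKK W) (\<phi> x, ?Z', ?z') (?z', ?Z', \<phi> v)"
      using that by (subst bracket) (simp_all add: pos neg)
    then show ?thesis
      using that
      by (simp add: V.bracket_TKK_neg_pos W.bracket_TKK_neg_pos mid neg
          V.box_op_mem_box_span del: TKK_simps)
  qed
  have T_eq: "T (x, h, y) = (\<phi> x, c h, \<phi> y)"
    if xhy: "x \<in> carrier V" "h \<in> box_span V" "y \<in> carrier V" for x h y
  proof -
    have mem: "(x, ?Z, ?z) \<in> carrier (TKK V)" "(?z, h, ?z) \<in> carrier (TKK V)"
      "(?z, ?Z, y) \<in> carrier (TKK V)"
      using xhy by simp_all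
    have "(x, h, y) = ((x, ?Z, ?z) \<oplus>\<^bsub>TKK V\<^esub> (?z, h, ?z)) \<oplus>\<^bsub>TKK V\<^esub> (?z, ?Z, y)"
      using xhy by (simp add: V.box_span_closed)
    also have "T \<dots> = (T (x, ?Z, ?z) \<oplus>\<^bsub>TKK W\<^esub> T (?z, h, ?z)) \<oplus>\<^bsub>TKK W\<^esub> T (?z, ?Z, y)"
      using mem by (simp add: linear_map_add[OF linear] V.TKK_closed del: TKK_simps)
    also have "\<dots> = (\<phi> x, c h, \<phi> y)"
      using xhy by (simp add: neg mid pos W.box_span_closed)
    finally show ?thesis .
  qed
  have \<phi>_add: "\<phi> (x \<oplus>\<^bsub>V\<^esub> y) = \<phi> x \<oplus>\<^bsub>W\<^esub> \<phi> y" if "x \<in> carrier V" "y \<in> carrier V" for x y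
    using linear_map_add[OF linear, of "(x, ?Z, ?z)" "(y, ?Z, ?z)"] that by (simp add: neg)
  have \<phi>_smult: "\<phi> (a \<odot>\<^bsub>V\<^esub> x) = a \<odot>\<^bsub>W\<^esub> \<phi> x" if "x \<in> carrier V" for x a
    using linear_map_smult[OF linear, of "(x, ?Z, ?z)" a] that V.smult_r_null[of "cnj a"]
      V.End.smult_r_null[of a]
    by (simp add: neg)
  have "inj_on \<phi> (carrier V)"
  proof (rule inj_onI)
    fix x y assume xy: "x \<in> carrier V" "y \<in> carrier V" "\<phi> x = \<phi> y"
    then have "T (x, ?Z, ?z) = T (y, ?Z, ?z)" by (simp add: neg)
    then show "x = y"
      using inj_onD[OF bij_betw_imp_inj_on[OF bij], of "(x, ?Z, ?z)" "(y, ?Z, ?z)"] xy by simp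
  qed
  moreover have "\<phi> ` carrier V = carrier W"
  proof
    show "carrier W \<subseteq> \<phi> ` carrier V"
    proof
      fix w assume "w \<in> carrier W"
      then have "(w, ?Z', ?z') \<in> T ` carrier (TKK V)"
        using bij by (simp add: bij_betw_def)
      then obtain p where p: "p \<in> carrier (TKK V)" "(w, ?Z', ?z') = T p" by blast
      then obtain x h y where "p = (x, h, y)" "x \<in> carrier V" "h \<in> box_span V" "y \<in> carrier V"
        by (blast elim: TKK_carrierE)
      then show "w \<in> \<phi> ` carrier V" using p(2) by (simp add: T_eq)
    qed
  qed (auto simp: neg)
  moreover have "\<phi> (tprod V x y z) = tprod W (\<phi> x) (\<phi> y) (\<phi> z)"
    if "x \<in> carrier V" "y \<in> carrier V" "z \<in> carrier V" for x y z
    using c_apply[of "box_op V x y" z] that by (simp add: V.box_op_mem_box_span c_box neg)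
  ultimately show \<phi>: "\<phi> \<in> triple_isos V W"
    by (auto simp: triple_isos_def bij_betw_def linear_map_def neg \<phi>_add \<phi>_smult)
       (simp add: \<phi>_def)
  then interpret jb_triple_iso V W \<phi> by unfold_locales
  show "TKK_map V W \<phi> = T"
  proof (rule extensionalityI[OF _ ext])
    show "TKK_map V W \<phi> \<in> extensional (carrier (TKK V))" by (simp add: TKK_map_def)
    fix p assume "p \<in> carrier (TKK V)"
    then obtain x h y where p: "p = (x, h, y)" "x \<in> carrier V" "h \<in> box_span V" "y \<in> carrier V"
      by (rule TKK_carrierE)
    have "conjugate h = c h"
      by (rule conjugate_eqI) (simp_all add: p V.box_span_closed W.box_span_closed mid c_apply)
    then show "TKK_map V W \<phi> p = T p"
      using p by (simp add: TKK_map_apply T_eq)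
  qed
qed

section \<open>The equivalence\<close>

lemma TKK_map_id:
  assumes "jb_triple V"
  shows "TKK_map V V (\<lambda>x\<in>carrier V. x) = (\<lambda>p\<in>carrier (TKK V). p)"
proof -
  interpret V: jb_triple V by fact
  interpret jb_triple_iso V V "\<lambda>x\<in>carrier V. x"
    using is_category_Ide[OF is_category_JB, of V] assms
    by unfold_locales (simp add: JB_category_def)
  show ?thesis
  proof (rule extensionalityI)
    fix p assume "p \<in> carrier (TKK V)"
    then obtain x h y where p: "p = (x, h, y)" "x \<in> carrier V" "h \<in> box_span V" "y \<in> carrier V"
      by (rule TKK_carrierE)
    have "conjugate h = h"
      by (rule conjugate_eqI) (simp_all add: p V.box_span_closed V.box_span_apply_closed)
    then show "TKK_map V V (\<lambda>x\<in>carrier V. x) p = (\<lambda>p\<in>carrier (TKK V). p) p"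
      using p by (simp add: TKK_map_apply)
  qed (simp_all add: TKK_map_def)
qed

lemma TKK_map_compose:
  assumes "jb_triple U" "jb_triple V" "jb_triple W"
    and f: "f \<in> triple_isos U V" and g: "g \<in> triple_isos V W"
  shows "TKK_map U W (compose (carrier U) g f)
    = compose (carrier (TKK U)) (TKK_map V W g) (TKK_map U V f)"
proof -
  interpret U: jb_triple U by fact
  interpret V: jb_triple V by fact
  interpret W: jb_triple W by fact
  interpret f: jb_triple_iso U V f using f by unfold_locales
  interpret g: jb_triple_iso V W g using g by unfold_locales
  interpret gf: jb_triple_iso U W "compose (carrier U) g f"
    using is_category_Comp[OF is_category_JB, of U V W f g] assms
    by unfold_locales (simp add: JB_category_def)
  show ?thesis
  proof (rule extensionalityI)
    fix p assume "p \<in> carrier (TKK U)"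
    then obtain x h y where p: "p = (x, h, y)" "x \<in> carrier U" "h \<in> box_span U" "y \<in> carrier U"
      by (rule TKK_carrierE)
    have "gf.conjugate h = g.conjugate (f.conjugate h)"
      by (rule gf.conjugate_eqI)
         (simp_all add: p U.box_span_closed U.box_span_apply_closed f.conjugate_closed g.conjugate_closed
           compose_eq f.conjugate_apply g.conjugate_apply)
    then show "TKK_map U W (compose (carrier U) g f) p
        = compose (carrier (TKK U)) (TKK_map V W g) (TKK_map U V f) p"
      using p by (simp add: TKK_map_apply compose_eq f.conjugate_mem_box_span)
  qed (simp_all add: TKK_map_def)
qed

text \<open>The first component of \<open>TKK_map V W f\<close> on the degree \<open>-1\<close> part is \<open>f\<close>.\<close>

lemma TKK_map_inject:
  assumes "jb_triple V" "f \<in> extensional (carrier V)" "g \<in> extensional (carrier V)"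
    and eq: "TKK_map V W f = TKK_map V W g"
  shows "f = g"
proof (rule extensionalityI[OF assms(2,3)])
  interpret V: jb_triple V by fact
  fix x assume "x \<in> carrier V"
  then have x: "(x, \<zero>\<^bsub>self_maps V\<^esub>, \<zero>\<^bsub>V\<^esub>) \<in> carrier (TKK V)" by (simp add: V.box_span_zero)
  have "fst (TKK_map V W f (x, \<zero>\<^bsub>self_maps V\<^esub>, \<zero>\<^bsub>V\<^esub>)) = fst (TKK_map V W g (x, \<zero>\<^bsub>self_maps V\<^esub>, \<zero>\<^bsub>V\<^esub>))"
    by (simp only: eq)
  then show "f x = g x" by (simp only: TKK_map_apply[OF x] fst_conv)
qed

lemma is_functor_TKK: "is_functor JB_category TKK_category TKK TKK_map"
  unfolding is_functor_def
proof (intro conjI ballI)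
  fix V W :: "'a normed_triple" and f
  assume "V \<in> Obj JB_category" "W \<in> Obj JB_category" "f \<in> Hom JB_category V W"
  then interpret jb_triple_iso V W f
    by (simp add: JB_category_def jb_triple_iso_def jb_triple_iso_axioms_def)
  show "TKK_map V W f \<in> Hom TKK_category (TKK V) (TKK W)"
    using TKK_map_mem by (simp add: TKK_category_def)
next
  fix U V W :: "'a normed_triple" and f g
  assume "U \<in> Obj JB_category" "V \<in> Obj JB_category" "W \<in> Obj JB_category"
    "f \<in> Hom JB_category U V" "g \<in> Hom JB_category V W"
  then show "TKK_map U W (Comp JB_category U V W g f)
      = Comp TKK_category (TKK U) (TKK V) (TKK W) (TKK_map V W g) (TKK_map U V f)"
    using TKK_map_compose[of U V W f g] by (simp add: JB_category_def TKK_category_def)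
qed (auto simp: JB_category_def TKK_category_def TKK_map_id)

theorem theorem2p2:
  shows "is_equivalence (JB_category :: ('a normed_triple, 'a \<Rightarrow> 'a) category)
           TKK_category TKK TKK_map"
proof (rule is_equivalence_if_fully_faithful)
  fix V W :: "'a normed_triple"
  assume "V \<in> Obj JB_category" "W \<in> Obj JB_category"
  then have jb: "jb_triple V" "jb_triple W" by (simp_all add: JB_category_def)
  have "inj_on (TKK_map V W) (triple_isos V W)"
    by (rule inj_onI) (auto simp: triple_isos_def intro: TKK_map_inject[OF jb(1)])
  moreover have "TKK_map V W ` triple_isos V W = graded_invol_isos (TKK V) (TKK W)"
  proof
    show "TKK_map V W ` triple_isos V W \<subseteq> graded_invol_isos (TKK V) (TKK W)"
      using is_functor_Hom[OF is_functor_TKK, of V W] jb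
      by (auto simp: JB_category_def TKK_category_def)
    show "graded_invol_isos (TKK V) (TKK W) \<subseteq> TKK_map V W ` triple_isos V W"
      using graded_invol_iso_is_TKK_map[OF jb] by (metis (no_types, lifting) image_eqI subsetI)
  qed
  ultimately show "bij_betw (TKK_map V W) (Hom JB_category V W) (Hom TKK_category (TKK V) (TKK W))"
    by (simp add: bij_betw_def JB_category_def TKK_category_def)
next
  show "Obj TKK_category \<subseteq> TKK ` (Obj JB_category :: 'a normed_triple set)"
    by (auto simp: JB_category_def TKK_category_def)
qed (fact is_category_JB is_category_TKK is_functor_TKK)+

end
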